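(* Let $1\le k<n$ be integers, let $E_1,\ldots,E_n$ be Banach spaces over $\mathbb{K}$, and let $A\in\mathcal{L}(E_1,\ldots,E_n;\mathbb{K})$ be such that the associated $k$-linear mapping $A_k$ is almost summing, i.e. $A_k\in\Pi_{as}(E_1,\ldots,E_k;\mathcal{L}(E_{k+1},\ldots,E_n;\mathbb{K}))$. Then $$\widehat{A}\colon \ell_2^w(E_1)\times\cdots\times\ell_2^w(E_k)\times Rad(E_{k+1})\times\cdots\times Rad(E_n)\longrightarrow \ell_1$$ is bounded, and moreover $\|\widehat{A}\|\le\|A_k\|_{as}$. In particular, $A\in\Pi_{(1;2,\ldots,2,1,\ldots,1)}(E_1,\ldots,E_n;\mathbb{K})$, where $2$ appears in the first $k$ positions and $1$ in the remaining $n-k$ positions.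
   Context: Banach spaces are over $\mathbb{K}=\mathbb{R}$ or $\mathbb{C}$; $E'$ is the topological dual of $E$ and $B_{E'}$ its closed unit ball. $\mathcal{L}(E_1,\ldots,E_n;F)$ is the Banach space of continuous $n$-linear mappings $E_1\times\cdots\times E_n\to F$ with the sup norm. For $p>0$, $\ell_p^w(E)$ is the space of sequences $(x_j)$ in $E$ with $(\varphi(x_j))_j\in\ell_p$ for all $\varphi\in E'$, with $\|(x_j)\|_{\ell_p^w(E)}=\sup_{\varphi\in B_{E'}}(\sum_j|\varphi(x_j)|^p)^{1/p}$ (the same formula is used for finite families). $Rad(E)$ is the space of sequences $(x_j)_{j\ge1}$ in $E$ with $\|(x_j)\|_{Rad(E)}=\sup_{m}\|\sum_{j=1}^m r_jx_j\|_{L^2([0,1],E)}<\infty$, where $r_j(t)=\mathrm{sign}(\sin 2^j\pi t)$ are the Rademacher functions. $A_k\colon E_1\times\cdots\times E_k\to\mathcal{L}(E_{k+1},\ldots,E_n;\mathbb{K})$ is defined by $A_k(x_1,\ldots,x_k)(x_{k+1},\ldots,x_n)=A(x_1,\ldots,x_n)$. A mapping $B\in\mathcal{L}(E_1,\ldots,E_k;F)$ is almost summing ($B\in\Pi_{as}(E_1,\ldots,E_k;F)$) if there is $C>0$ with $\|(B(x_j^1,\ldots,x_j^k))_{j=1}^m\|_{Rad(F)}\le C\prod_{i=1}^k\|(x_j^i)_{j=1}^m\|_{\ell_2^w(E_i)}$ for all $m$ and all finite families $(x_j^i)_{j=1}^m\subseteq E_i$; $\|B\|_{as}$ is the infimum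 of such $C$. $\widehat{A}$ is the mapping $\widehat{A}((x_j^1)_j,\ldots,(x_j^n)_j)=(A(x_j^1,\ldots,x_j^n))_j$, defined on $\ell_\infty(E_1)\times\cdots\times\ell_\infty(E_n)$ with values in $\ell_\infty$. For (normed) sequence spaces $X_i\subseteq\ell_\infty(E_i)$, $Y\subseteq \ell_\infty$, saying that $\widehat{A}\colon X_1\times\cdots\times X_n\to Y$ is bounded means that the restriction of $\widehat{A}$ to $X_1\times\cdots\times X_n$ is well defined, $Y$-valued and continuous; $\|\widehat A\|$ is then its norm as an $n$-linear mapping. For $0<p,p_1,\ldots,p_n\le\infty$ with $\frac1p\le\frac1{p_1}+\cdots+\frac1{p_n}$, $\Pi_{(p;p_1,\ldots,p_n)}(E_1,\ldots,E_n;F)$ is the space of absolutely $(p;p_1,\ldots,p_n)$-summing mappings, i.e. those $A\in\mathcal{L}(E_1,\ldots,E_n;F)$ for which there is $C>0$ with $\|(A(x_j^1,\ldots,x_j^n))_{j=1}^m\|_{p}\le C\prod_{i=1}^n\|(x_j^i)_{j=1}^m\|_{\ell_{p_i}^w(E_i)}$ for all finite families $x_1^i,\ldots,x_m^i\in E_i$, where $\|\cdot\|_p$ is the $\ell_p(F)$-norm. *)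

theory Defs
  imports "HOL-Analysis.Analysis" "HOL-Library.Function_Algebras"
begin

text \<open>
  A normed space over a scalar field K, where K is the set of real numbers inside the complex
  numbers or all of them. The record consists of the underlying set, the scalar multiplication and
  the norm; addition is that of the ambient abelian group. Putting all members of a family
  $E_1, \dots, E_n$ into one ambient group is no restriction: use the product of the
  $E_i$ and its coordinate axes. Only scalars in K and vectors in the underlying set matter.
\<close>

record 'a nspace =
  vecs :: "'a set"
  scl :: "complex \<Rightarrow> 'a \<Rightarrow> 'a"
  nrm :: "'a \<Rightarrow> real"

locale banach_over =
  fixes K :: "complex set" and X :: "'a::ab_group_add nspace"
  assumes zero_closed: "0 \<in> vecs X"
    and add_closed: "x \<in> vecs X \<Longrightarrow> y \<in> vecs X \<Longrightarrow> x + y \<in> vecs X"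
    and scl_closed: "c \<in> K \<Longrightarrow> x \<in> vecs X \<Longrightarrow> scl X c x \<in> vecs X"
    and scl_add_right:
      "c \<in> K \<Longrightarrow> x \<in> vecs X \<Longrightarrow> y \<in> vecs X \<Longrightarrow> scl X c (x + y) = scl X c x + scl X c y"
    and scl_add_left:
      "c \<in> K \<Longrightarrow> d \<in> K \<Longrightarrow> x \<in> vecs X \<Longrightarrow> scl X (c + d) x = scl X c x + scl X d x"
    and scl_scl: "c \<in> K \<Longrightarrow> d \<in> K \<Longrightarrow> x \<in> vecs X \<Longrightarrow> scl X c (scl X d x) = scl X (c * d) x"
    and scl_one: "x \<in> vecs X \<Longrightarrow> scl X 1 x = x"
    and nrm_definite: "x \<in> vecs X \<Longrightarrow> nrm X x = 0 \<Longrightarrow> x = 0"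
    and nrm_triangle: "x \<in> vecs X \<Longrightarrow> y \<in> vecs X \<Longrightarrow> nrm X (x + y) \<le> nrm X x + nrm X y"
    and nrm_scl: "c \<in> K \<Longrightarrow> x \<in> vecs X \<Longrightarrow> nrm X (scl X c x) = norm c * nrm X x"
    and complete:
      "(\<And>j. s j \<in> vecs X) \<Longrightarrow> (\<And>e. e > 0 \<Longrightarrow> \<exists>N. \<forall>i\<ge>N. \<forall>j\<ge>N. nrm X (s i - s j) < e)
        \<Longrightarrow> \<exists>x\<in>vecs X. (\<lambda>j. nrm X (s j - x)) \<longlonglongrightarrow> 0"

definition scalars :: "complex set \<Rightarrow> complex nspace" where
  "scalars K = \<lparr>vecs = K, scl = (*), nrm = norm\<rparr>"


subsection \<open>Continuous multilinear mappings\<close>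

definition tuples :: "nat set \<Rightarrow> (nat \<Rightarrow> 'a nspace) \<Rightarrow> (nat \<Rightarrow> 'a) set" where
  "tuples I E = (\<Pi>\<^sub>E i\<in>I. vecs (E i))"

definition multilinear ::
  "complex set \<Rightarrow> nat set \<Rightarrow> (nat \<Rightarrow> 'a::ab_group_add nspace) \<Rightarrow> 'b::ab_group_add nspace
    \<Rightarrow> ((nat \<Rightarrow> 'a) \<Rightarrow> 'b) \<Rightarrow> bool" where
  "multilinear K I E F T \<longleftrightarrow>
    (\<forall>x\<in>tuples I E. \<forall>i\<in>I. \<forall>y\<in>vecs (E i). \<forall>z\<in>vecs (E i).
      T (x(i := y + z)) = T (x(i := y)) + T (x(i := z))) \<and>
    (\<forall>x\<in>tuples I E. \<forall>i\<in>I. \<forall>y\<in>vecs (E i). \<forall>c\<in>K.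
      T (x(i := scl (E i) c y)) = scl F c (T (x(i := y))))"

text \<open>Continuity on a finite product, for the maximum metric.\<close>

definition continuous_map_on ::
  "nat set \<Rightarrow> (nat \<Rightarrow> 'a::ab_group_add nspace) \<Rightarrow> 'b::ab_group_add nspace
    \<Rightarrow> ((nat \<Rightarrow> 'a) \<Rightarrow> 'b) \<Rightarrow> bool" where
  "continuous_map_on I E F T \<longleftrightarrow>
    (\<forall>x\<in>tuples I E. \<forall>e>0. \<exists>d>0. \<forall>y\<in>tuples I E.
      (\<forall>i\<in>I. nrm (E i) (y i - x i) < d) \<longrightarrow> nrm F (T y - T x) < e)"

definition op_norm ::
  "nat set \<Rightarrow> (nat \<Rightarrow> 'a nspace) \<Rightarrow> 'b nspace \<Rightarrow> ((nat \<Rightarrow> 'a) \<Rightarrow> 'b) \<Rightarrow> real" where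
  "op_norm I E F T =
    (SUP x \<in> {x \<in> tuples I E. \<forall>i\<in>I. nrm (E i) (x i) \<le> 1}. nrm F (T x))"

text \<open>
  The space of continuous multilinear mappings on the product of the $E_i$, $i \in I$. Mappings are
  total functions in HOL; they are normalised to be 0 off the product, so that they are determined
  by their values on the product.
\<close>

definition mult_space ::
  "complex set \<Rightarrow> nat set \<Rightarrow> (nat \<Rightarrow> 'a::ab_group_add nspace) \<Rightarrow> 'b::ab_group_add nspace
    \<Rightarrow> ((nat \<Rightarrow> 'a) \<Rightarrow> 'b) nspace" where
  "mult_space K I E F =
    \<lparr>vecs = {T. (\<forall>x\<in>tuples I E. T x \<in> vecs F) \<and> (\<forall>x. x \<notin> tuples I E \<longrightarrow> T x = 0) \<and>
               multilinear K I E F T \<and> continuous_map_on I E F T},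
     scl = (\<lambda>c T x. scl F c (T x)),
     nrm = op_norm I E F\<rparr>"

text \<open>The mapping $A_k$ associated with $A$.\<close>

definition assoc_map ::
  "nat \<Rightarrow> nat \<Rightarrow> (nat \<Rightarrow> 'a nspace) \<Rightarrow> ((nat \<Rightarrow> 'a) \<Rightarrow> complex)
    \<Rightarrow> (nat \<Rightarrow> 'a) \<Rightarrow> (nat \<Rightarrow> 'a) \<Rightarrow> complex" where
  "assoc_map k n E A x y =
    (if x \<in> tuples {1..k} E \<and> y \<in> tuples {k+1..n} E
     then A (merge {1..k} {k+1..n} (x, y)) else 0)"


subsection \<open>Sequence spaces\<close>

text \<open>
  Sequences are indexed from 0, so \<open>x j\<close> is the term with index $j + 1$ of the usual
  numbering. A finite family of length m is identified with its extension by 0.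
\<close>

definition fin_family :: "nat \<Rightarrow> (nat \<Rightarrow> 'a::zero) \<Rightarrow> nat \<Rightarrow> 'a" where
  "fin_family m x = (\<lambda>j. if j < m then x j else 0)"

definition lp_space :: "real \<Rightarrow> 'a nspace \<Rightarrow> (nat \<Rightarrow> 'a) nspace" where
  "lp_space p F =
    \<lparr>vecs = {x. (\<forall>j. x j \<in> vecs F) \<and> summable (\<lambda>j. nrm F (x j) powr p)},
     scl = (\<lambda>c x j. scl F c (x j)),
     nrm = (\<lambda>x. (\<Sum>j. nrm F (x j) powr p) powr (1 / p))\<rparr>"

definition dual :: "complex set \<Rightarrow> 'a::ab_group_add nspace \<Rightarrow> ('a \<Rightarrow> complex) set" where
  "dual K X = {\<phi>. (\<forall>x\<in>vecs X. \<phi> x \<in> K) \<and>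
     (\<forall>x\<in>vecs X. \<forall>y\<in>vecs X. \<phi> (x + y) = \<phi> x + \<phi> y) \<and>
     (\<forall>c\<in>K. \<forall>x\<in>vecs X. \<phi> (scl X c x) = c * \<phi> x) \<and>
     (\<forall>x\<in>vecs X. \<forall>e>0. \<exists>d>0. \<forall>y\<in>vecs X. nrm X (y - x) < d \<longrightarrow> norm (\<phi> y - \<phi> x) < e)}"

definition dual_norm :: "'a nspace \<Rightarrow> ('a \<Rightarrow> complex) \<Rightarrow> real" where
  "dual_norm X \<phi> = (SUP x \<in> {x \<in> vecs X. nrm X x \<le> 1}. norm (\<phi> x))"

definition dual_ball :: "complex set \<Rightarrow> 'a::ab_group_add nspace \<Rightarrow> ('a \<Rightarrow> complex) set" where
  "dual_ball K X = {\<phi> \<in> dual K X. dual_norm X \<phi> \<le> 1}"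

definition weak_lp :: "complex set \<Rightarrow> real \<Rightarrow> 'a::ab_group_add nspace \<Rightarrow> (nat \<Rightarrow> 'a) nspace" where
  "weak_lp K p X =
    \<lparr>vecs = {x. (\<forall>j. x j \<in> vecs X) \<and>
               (\<forall>\<phi>\<in>dual K X. (\<lambda>j. \<phi> (x j)) \<in> vecs (lp_space p (scalars K)))},
     scl = (\<lambda>c x j. scl X c (x j)),
     nrm = (\<lambda>x. SUP \<phi> \<in> dual_ball K X. nrm (lp_space p (scalars K)) (\<lambda>j. \<phi> (x j)))\<rparr>"

definition rademacher :: "nat \<Rightarrow> real \<Rightarrow> real" where
  "rademacher j t = sgn (sin (2 ^ j * pi * t))"

definition L2_norm :: "'a nspace \<Rightarrow> (real \<Rightarrow> 'a) \<Rightarrow> real" where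
  "L2_norm X f = sqrt (LINT t:{0..1}|lborel. (nrm X (f t))\<^sup>2)"

definition rad_sum :: "'a::ab_group_add nspace \<Rightarrow> (nat \<Rightarrow> 'a) \<Rightarrow> nat \<Rightarrow> real \<Rightarrow> 'a" where
  "rad_sum X x m t = (\<Sum>j<m. scl X (of_real (rademacher (j + 1) t)) (x j))"

definition Rad :: "'a::ab_group_add nspace \<Rightarrow> (nat \<Rightarrow> 'a) nspace" where
  "Rad X =
    \<lparr>vecs = {x. (\<forall>j. x j \<in> vecs X) \<and> bdd_above (range (\<lambda>m. L2_norm X (rad_sum X x m)))},
     scl = (\<lambda>c x j. scl X c (x j)),
     nrm = (\<lambda>x. SUP m. L2_norm X (rad_sum X x m))\<rparr>"


subsection \<open>Summing mappings\<close>

text \<open>In the next definitions \<open>x j i\<close> is the $i$-th coordinate of the $j$-th tuple.\<close>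

definition as_bound ::
  "complex set \<Rightarrow> nat set \<Rightarrow> (nat \<Rightarrow> 'a::ab_group_add nspace) \<Rightarrow> 'b::ab_group_add nspace
    \<Rightarrow> ((nat \<Rightarrow> 'a) \<Rightarrow> 'b) \<Rightarrow> real \<Rightarrow> bool" where
  "as_bound K I E F B C \<longleftrightarrow>
    (\<forall>m x. (\<forall>j<m. x j \<in> tuples I E) \<longrightarrow>
      nrm (Rad F) (fin_family m (\<lambda>j. B (x j)))
        \<le> C * (\<Prod>i\<in>I. nrm (weak_lp K 2 (E i)) (fin_family m (\<lambda>j. x j i))))"

definition almost_summing ::
  "complex set \<Rightarrow> nat set \<Rightarrow> (nat \<Rightarrow> 'a::ab_group_add nspace) \<Rightarrow> 'b::ab_group_add nspace
    \<Rightarrow> ((nat \<Rightarrow> 'a) \<Rightarrow> 'b) set" where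
  "almost_summing K I E F =
    {B \<in> vecs (mult_space K I E F). \<exists>C>0. as_bound K I E F B C}"

definition as_norm ::
  "complex set \<Rightarrow> nat set \<Rightarrow> (nat \<Rightarrow> 'a::ab_group_add nspace) \<Rightarrow> 'b::ab_group_add nspace
    \<Rightarrow> ((nat \<Rightarrow> 'a) \<Rightarrow> 'b) \<Rightarrow> real" where
  "as_norm K I E F B = Inf {C. C > 0 \<and> as_bound K I E F B C}"

text \<open>Absolutely $(p; (p_i)_{i \in I})$-summing mappings, for finite exponents.\<close>

definition abs_summing ::
  "complex set \<Rightarrow> nat set \<Rightarrow> real \<Rightarrow> (nat \<Rightarrow> real) \<Rightarrow> (nat \<Rightarrow> 'a::ab_group_add nspace)
    \<Rightarrow> 'b::ab_group_add nspace \<Rightarrow> ((nat \<Rightarrow> 'a) \<Rightarrow> 'b) set" where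
  "abs_summing K I p q E F =
    {A \<in> vecs (mult_space K I E F). \<exists>C>0. \<forall>m x. (\<forall>j<m. x j \<in> tuples I E) \<longrightarrow>
      nrm (lp_space p F) (fin_family m (\<lambda>j. A (x j)))
        \<le> C * (\<Prod>i\<in>I. nrm (weak_lp K (q i) (E i)) (fin_family m (\<lambda>j. x j i)))}"


subsection \<open>The induced mapping on sequence spaces\<close>

definition seq_map :: "nat set \<Rightarrow> ((nat \<Rightarrow> 'a) \<Rightarrow> 'b) \<Rightarrow> (nat \<Rightarrow> nat \<Rightarrow> 'a) \<Rightarrow> nat \<Rightarrow> 'b" where
  "seq_map I A s = (\<lambda>j. A (\<lambda>i\<in>I. s i j))"

definition bounded_between ::
  "nat set \<Rightarrow> (nat \<Rightarrow> 'a::ab_group_add nspace) \<Rightarrow> 'b::ab_group_add nspace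
    \<Rightarrow> ((nat \<Rightarrow> 'a) \<Rightarrow> 'b) \<Rightarrow> bool" where
  "bounded_between I X Y T \<longleftrightarrow>
    (\<forall>s\<in>tuples I X. T s \<in> vecs Y) \<and> continuous_map_on I X Y T"

end

theory Submission imports Defs begin

text \<open>
  For signs $\varepsilon^{(i)}_j = r_j(t_i)$ with independent $t_{k+1}, \dots, t_n$, orthogonality in
  each slot gives that the sum of the $A_k(u_j)(x^{k+1}_j, \dots, x^n_j)$ is the mean of
  $(\sum_j \prod_i \varepsilon^{(i)}_j A_k(u_j))(\sum_a \varepsilon^{(k+1)}_a x^{k+1}_a, \dots,
  \sum_a \varepsilon^{(n)}_a x^n_a)$. The products of the signs are again Rademacher distributed, so
  Cauchy--Schwarz bounds the mean by the Rad norm of $(A_k(u_j))_j$ times those of the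
  $(x^i_j)_j$. The weak norms are finite by uniform boundedness on the dual, and in the last $n - k$
  slots the weak $\ell_1$ norm dominates the Rad norm by Hahn--Banach.
\<close>

text \<open>\<open>SUP\<close> over the reals says nothing about an unbounded set, so a weak norm, a
  \<open>Rad\<close> norm or an \<open>op_norm\<close> bounds its members only once the set behind
  it is shown to be bounded. For infinite sequences in \<open>weak_lp K 2\<close> this costs the
  uniform boundedness argument; for the values of A_k it costs a bound on the unit ball drawn from
  continuity. The integrals over [0,1] are eliminated early: the \<open>L2_norm\<close> of a
  Rademacher sum of length m is exactly the root of a mean over 2^m sign vectors, so orthogonality
  and Cauchy-Schwarz concern finite sums, and independence becomes iteration of means. The main
  estimate loses no constant: for the first m terms it holds with every admissible C itself. It
  yields membership in l_1, the bound on the norm by passing to the infimum over C, and the summing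
  property. Both bounds on k enter: 1 <= k supplies a slot in which A is turned into its modulus,
  and k < n supplies a slot to average over.\<close>

locale banach_RC = banach_over K X for K :: "complex set" and X :: "'a::ab_group_add nspace" +
  assumes real_or_complex: "K = \<real> \<or> K = UNIV"
begin

lemma of_real_K [simp, intro]: "complex_of_real t \<in> K"
  and zero_K [simp, intro]: "0 \<in> K" and one_K [simp, intro]: "1 \<in> K"
  and neg_one_K [simp, intro]: "-1 \<in> K"
  using real_or_complex by auto

lemma mult_K: "c \<in> K \<Longrightarrow> d \<in> K \<Longrightarrow> c * d \<in> K"
  and add_K: "c \<in> K \<Longrightarrow> d \<in> K \<Longrightarrow> c + d \<in> K"
  using real_or_complex by auto

lemma closed_K: "closed K"
  using real_or_complex closed_complex_Reals by auto

lemma scl_zero_left [simp]: "x \<in> vecs X \<Longrightarrow> scl X 0 x = 0"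
  using scl_add_left[of 0 0 x] by simp

lemma scl_zero_right [simp]: "c \<in> K \<Longrightarrow> scl X c 0 = 0"
  using scl_add_right[of c 0 0] zero_closed by simp

lemma scl_neg_one: "x \<in> vecs X \<Longrightarrow> scl X (-1) x = - x"
  using scl_add_left[of 1 "-1" x] scl_one[of x] by (simp add: minus_unique)

lemma minus_closed: "x \<in> vecs X \<Longrightarrow> - x \<in> vecs X"
  by (metis neg_one_K scl_closed scl_neg_one)

lemma diff_closed: "x \<in> vecs X \<Longrightarrow> y \<in> vecs X \<Longrightarrow> x - y \<in> vecs X"
  using add_closed[of x "- y"] minus_closed by simp

lemma sum_closed: "(\<And>j. j \<in> J \<Longrightarrow> f j \<in> vecs X) \<Longrightarrow> sum f J \<in> vecs X"
  by (induction J rule: infinite_finite_induct) (auto simp: zero_closed add_closed)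

lemma nrm_zero [simp]: "nrm X 0 = 0"
  using nrm_scl[of 0 0] zero_closed by simp

lemma nrm_minus: "x \<in> vecs X \<Longrightarrow> nrm X (- x) = nrm X x"
  using nrm_scl[of "-1" x] scl_neg_one by simp

lemma nrm_nonneg: "x \<in> vecs X \<Longrightarrow> 0 \<le> nrm X x"
  using nrm_triangle[of x "- x"] nrm_minus minus_closed by simp

subsection \<open>Norming functionals\<close>

text \<open>Homogeneity is required only as an inequality, which passes to infima; rescaling by 1/t
  recovers equality in \<open>sublinear_scl_eq\<close>.\<close>

definition sublinear :: "('a \<Rightarrow> real) \<Rightarrow> bool" where
  "sublinear p \<longleftrightarrow>
    (\<forall>x\<in>vecs X. \<forall>y\<in>vecs X. p (x + y) \<le> p x + p y) \<and>
    (\<forall>x\<in>vecs X. \<forall>t\<ge>0. p (scl X (of_real t) x) \<le> t * p x)"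

lemma sublinear_add: "sublinear p \<Longrightarrow> x \<in> vecs X \<Longrightarrow> y \<in> vecs X \<Longrightarrow> p (x + y) \<le> p x + p y"
  and sublinear_scl: "sublinear p \<Longrightarrow> x \<in> vecs X \<Longrightarrow> t \<ge> 0 \<Longrightarrow> p (scl X (of_real t) x) \<le> t * p x"
  by (auto simp: sublinear_def)

lemma sublinear_zero: "sublinear p \<Longrightarrow> p 0 = 0"
  using sublinear_add[of p 0 0] sublinear_scl[of p 0 0] zero_closed by simp

lemma sublinear_minus: "sublinear p \<Longrightarrow> x \<in> vecs X \<Longrightarrow> - p (- x) \<le> p x"
  using sublinear_add[of p x "- x"] sublinear_zero[of p] minus_closed by simp

lemma sublinear_scl_eq:
  assumes p: "sublinear p" and x: "x \<in> vecs X" and t: "t \<ge> 0"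
  shows "p (scl X (of_real t) x) = t * p x"
proof (cases "t = 0")
  case True
  then show ?thesis using sublinear_zero[OF p] x by simp
next
  case False
  then have "p x = p (scl X (of_real (1 / t)) (scl X (of_real t) x))"
    using x by (simp only: scl_scl[OF of_real_K of_real_K x] flip: of_real_mult) (simp add: scl_one)
  also have "\<dots> \<le> 1 / t * p (scl X (of_real t) x)"
    using p x t by (intro sublinear_scl) (auto intro: scl_closed)
  finally have "t * p x \<le> p (scl X (of_real t) x)"
    using t False by (simp add: field_simps)
  then show ?thesis using sublinear_scl[OF p x t] by simp
qed

text \<open>The Hahn-Banach device: t = 0 puts it below \<open>p\<close>, and t = 1 at
  \<open>- v\<close> gives at most \<open>- p v\<close>, so a linear minorant has value at least
  \<open>p v\<close> at \<open>v\<close>.\<close>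

definition shift :: "('a \<Rightarrow> real) \<Rightarrow> 'a \<Rightarrow> 'a \<Rightarrow> real" where
  "shift p v x = (INF t\<in>{0..}. p (x + scl X (of_real t) v) - t * p v)"

text \<open>The infimum is a true lower bound because its set is bounded below by
  \<open>- p (- x)\<close>, as s v = (x + s v) + (- x).\<close>

lemma shift_le:
  assumes p: "sublinear p" and v: "v \<in> vecs X" and x: "x \<in> vecs X" and t: "t \<ge> 0"
  shows "shift p v x \<le> p (x + scl X (of_real t) v) - t * p v"
  unfolding shift_def
proof (rule cINF_lower)
  have "- p (- x) \<le> p (x + scl X (of_real s) v) - s * p v" if s: "s \<ge> 0" for s
  proof -
    have "s * p v = p ((x + scl X (of_real s) v) + - x)"
      using sublinear_scl_eq[OF p v s] by simp
    also have "\<dots> \<le> p (x + scl X (of_real s) v) + p (- x)"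
      using x v by (intro sublinear_add[OF p]) (auto intro: add_closed scl_closed minus_closed)
    finally show ?thesis by simp
  qed
  then show "bdd_below ((\<lambda>t. p (x + scl X (of_real t) v) - t * p v) ` {0..})"
    by (auto intro!: bdd_belowI[of _ "- p (- x)"])
qed (use t in auto)

text \<open>Parameters s for x and t for y combine to s + t for x + y, and s for x becomes t * s for
  t x; infima over the separate parameters then give both laws.\<close>

lemma shift_sublinear:
  assumes p: "sublinear p" and v: "v \<in> vecs X"
  shows "sublinear (shift p v)"
  unfolding sublinear_def
proof (intro conjI ballI allI impI)
  fix x y assume x: "x \<in> vecs X" and y: "y \<in> vecs X"
  have *: "shift p v (x + y) \<le>
      (p (x + scl X (of_real s) v) - s * p v) + (p (y + scl X (of_real t) v) - t * p v)"
    if "s \<ge> 0" "t \<ge> 0" for s t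
  proof -
    have "shift p v (x + y) \<le> p ((x + y) + scl X (of_real (s + t)) v) - (s + t) * p v"
      using that x y by (intro shift_le[OF p v]) (auto intro: add_closed)
    also have "(x + y) + scl X (of_real (s + t)) v
        = (x + scl X (of_real s) v) + (y + scl X (of_real t) v)"
      using v by (simp add: scl_add_left)
    also have "p \<dots> \<le> p (x + scl X (of_real s) v) + p (y + scl X (of_real t) v)"
      using x y v by (intro sublinear_add[OF p]) (auto intro: add_closed scl_closed)
    finally show ?thesis by (simp add: algebra_simps)
  qed
  have "shift p v (x + y) - (p (y + scl X (of_real t) v) - t * p v) \<le> shift p v x"
    if "t \<ge> 0" for t
    unfolding shift_def[of p v x] using *[OF _ that] by (intro cINF_greatest) (auto simp: algebra_simps)
  then have "shift p v (x + y) - shift p v x \<le> shift p v y"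
    unfolding shift_def[of p v y] by (intro cINF_greatest) (auto simp: algebra_simps)
  then show "shift p v (x + y) \<le> shift p v x + shift p v y" by simp
next
  fix x and t :: real assume x: "x \<in> vecs X" and t: "t \<ge> 0"
  show "shift p v (scl X (of_real t) x) \<le> t * shift p v x"
  proof (cases "t = 0")
    case True
    then show ?thesis using shift_le[OF p v zero_closed, of 0] x v sublinear_zero[OF p] by simp
  next
    case False
    have "shift p v (scl X (of_real t) x) / t \<le> p (x + scl X (of_real s) v) - s * p v"
      if s: "s \<ge> 0" for s
    proof -
      have "shift p v (scl X (of_real t) x)
          \<le> p (scl X (of_real t) x + scl X (of_real (t * s)) v) - (t * s) * p v"
        using s t x by (intro shift_le[OF p v]) (auto intro: scl_closed)
      also have "scl X (of_real t) x + scl X (of_real (t * s)) v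
          = scl X (of_real t) (x + scl X (of_real s) v)"
        using x v by (simp add: scl_add_right scl_scl scl_closed)
      also have "p \<dots> \<le> t * p (x + scl X (of_real s) v)"
        using x v t by (intro sublinear_scl[OF p]) (auto intro: add_closed scl_closed)
      finally show ?thesis using t False by (simp add: field_simps)
    qed
    then have "shift p v (scl X (of_real t) x) / t \<le> shift p v x"
      unfolding shift_def[of p v x] by (intro cINF_greatest) auto
    then show ?thesis using t False by (simp add: field_simps)
  qed
qed

lemma nrm_sublinear: "sublinear (nrm X)"
  unfolding sublinear_def using nrm_triangle by (auto simp: nrm_scl)

text \<open>Zorn's lemma for the reversed pointwise order. The pointwise infimum of a chain is again
  sublinear because the smaller of two members serves for both summands.\<close>

lemma minimal_sublinear:
  assumes q: "sublinear q"
  obtains p where "sublinear p" "\<And>x. x \<in> vecs X \<Longrightarrow> p x \<le> q x"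
    "\<And>r x. sublinear r \<Longrightarrow> (\<And>x. x \<in> vecs X \<Longrightarrow> r x \<le> p x) \<Longrightarrow> x \<in> vecs X \<Longrightarrow> p x \<le> r x"
proof -
  \<comment> \<open>Members of \<open>S\<close> are 0 off the carrier, so that the pointwise order
    on total functions compares them on the carrier only.\<close>
  define cut where "cut p = (\<lambda>x. if x \<in> vecs X then p x else 0)" for p :: "'a \<Rightarrow> real"
  have cut: "sublinear (cut p) \<longleftrightarrow> sublinear p" for p
    unfolding sublinear_def cut_def by (simp add: add_closed scl_closed)
  define S where "S = {p. sublinear p \<and> (\<forall>x. x \<notin> vecs X \<longrightarrow> p x = 0) \<and> (\<forall>x\<in>vecs X. p x \<le> q x)}"
  \<comment> \<open>A lower bound common to all of \<open>S\<close>, which makes the infimum over a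
    chain finite.\<close>
  have below: "- q (- x) \<le> p x" if "p \<in> S" "x \<in> vecs X" for p x
    using that sublinear_minus[of p x] minus_closed[of x] unfolding S_def
    by (metis (mono_tags, lifting) le_imp_neg_le mem_Collect_eq order_trans)
  have "\<exists>m\<in>S. \<forall>a\<in>S. a \<le> m \<longrightarrow> a = m"
  proof (rule predicate_Zorn)
    show "partial_order_on S (relation_of (\<lambda>a b. b \<le> a) S)"
      by (rule partial_order_on_relation_ofI) auto
  next
    fix C assume "C \<in> Chains (relation_of (\<lambda>a b. b \<le> a) S)"
    then have CS: "C \<subseteq> S" and tot: "\<And>a b. a \<in> C \<Longrightarrow> b \<in> C \<Longrightarrow> a \<le> b \<or> b \<le> a"
      by (auto simp: Chains_def relation_of_def)
    show "\<exists>u\<in>S. \<forall>a\<in>C. u \<le> a"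
    proof (cases "C = {}")
      case True
      have "cut q \<in> S" using q cut unfolding S_def by (auto simp: cut_def)
      then show ?thesis using True by auto
    next
      case False
      define u where "u = cut (\<lambda>x. INF p\<in>C. p x)"
      have u_le: "u x \<le> p x" if "p \<in> C" for p x
      proof (cases "x \<in> vecs X")
        case True
        then have "bdd_below ((\<lambda>p. p x) ` C)" using below CS by (auto intro!: bdd_belowI)
        then show ?thesis using that True by (auto simp: u_def cut_def intro: cINF_lower)
      next
        case False
        then show ?thesis using that CS by (auto simp: u_def cut_def S_def)
      qed
      have u_ge: "c \<le> u x" if "x \<in> vecs X" "\<And>p. p \<in> C \<Longrightarrow> c \<le> p x" for c x
        using that \<open>C \<noteq> {}\<close> by (auto simp: u_def cut_def intro: cINF_greatest)
      have sub: "sublinear p" if "p \<in> C" for p using that CS by (auto simp: S_def)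
      have "sublinear u"
        unfolding sublinear_def
      proof (intro conjI ballI allI impI)
        fix x y assume x: "x \<in> vecs X" and y: "y \<in> vecs X"
        have *: "u (x + y) \<le> p1 x + p2 y" if p12: "p1 \<in> C" "p2 \<in> C" for p1 p2
        proof -
          obtain p where p: "p \<in> C" "p \<le> p1" "p \<le> p2" using tot[OF p12] p12 by blast
          have "u (x + y) \<le> p (x + y)" using u_le p by auto
          also have "\<dots> \<le> p x + p y" using sublinear_add[OF sub x y] p by auto
          also have "\<dots> \<le> p1 x + p2 y" using p by (auto simp: le_fun_def intro: add_mono)
          finally show ?thesis .
        qed
        have "u (x + y) - p2 y \<le> u x" if "p2 \<in> C" for p2
          using *[OF _ that] x by (intro u_ge) (auto simp: algebra_simps)
        then have "u (x + y) - u x \<le> u y"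
          using y by (intro u_ge) (auto simp: algebra_simps)
        then show "u (x + y) \<le> u x + u y" by simp
      next
        fix x and t :: real assume x: "x \<in> vecs X" and t: "t \<ge> 0"
        show "u (scl X (of_real t) x) \<le> t * u x"
        proof (cases "t = 0")
          case True
          obtain p where "p \<in> C" using \<open>C \<noteq> {}\<close> by auto
          then show ?thesis using True x u_le[of p 0] sublinear_zero[OF sub[of p]] by simp
        next
          case False
          have "u (scl X (of_real t) x) / t \<le> u x"
          proof (rule u_ge[OF x])
            fix p assume p: "p \<in> C"
            have "u (scl X (of_real t) x) \<le> p (scl X (of_real t) x)" using u_le p by auto
            also have "\<dots> \<le> t * p x" using sublinear_scl[OF sub x t] p by auto
            finally show "u (scl X (of_real t) x) / t \<le> p x"
              using t False by (simp add: field_simps)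
          qed
          then show ?thesis using t False by (simp add: field_simps)
        qed
      qed
      moreover obtain p where "p \<in> C" using \<open>C \<noteq> {}\<close> by auto
      moreover have "u x \<le> q x" if "x \<in> vecs X" for x
        using u_le[OF \<open>p \<in> C\<close>, of x] CS \<open>p \<in> C\<close> that by (force simp: S_def)
      ultimately have "u \<in> S" by (simp add: S_def) (simp add: u_def cut_def)
      then show ?thesis using u_le by (auto simp: le_fun_def)
    qed
  qed
  then obtain p where p: "p \<in> S" and min: "\<And>a. a \<in> S \<Longrightarrow> a \<le> p \<Longrightarrow> a = p" by blast
  show thesis
  proof (rule that)
    show "sublinear p" "x \<in> vecs X \<Longrightarrow> p x \<le> q x" for x using p by (auto simp: S_def)
  next
    fix r x assume r: "sublinear r" "\<And>x. x \<in> vecs X \<Longrightarrow> r x \<le> p x" and x: "x \<in> vecs X"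
    have "cut r \<in> S" "cut r \<le> p"
      using r p cut by (force simp: S_def cut_def le_fun_def)+
    then have "cut r = p" by (rule min)
    then show "p x \<le> r x" using x by (auto simp: cut_def)
  qed
qed

text \<open>
  A minimal sublinear functional below q is linear, because it cannot be lowered by shift.
  Starting from \<open>q = shift (nrm X) x0\<close> forces its value at x0.
\<close>

lemma norming_real_linear:
  assumes x0: "x0 \<in> vecs X"
  obtains p :: "'a \<Rightarrow> real" where
    "\<And>x y. x \<in> vecs X \<Longrightarrow> y \<in> vecs X \<Longrightarrow> p (x + y) = p x + p y"
    "\<And>t x. x \<in> vecs X \<Longrightarrow> p (scl X (of_real t) x) = t * p x"
    "\<And>x. x \<in> vecs X \<Longrightarrow> p x \<le> nrm X x"
    "nrm X x0 \<le> p x0"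
proof -
  obtain p where p: "sublinear p" and le: "\<And>x. x \<in> vecs X \<Longrightarrow> p x \<le> shift (nrm X) x0 x"
    and min: "\<And>r x. sublinear r \<Longrightarrow> (\<And>x. x \<in> vecs X \<Longrightarrow> r x \<le> p x) \<Longrightarrow> x \<in> vecs X \<Longrightarrow> p x \<le> r x"
    using minimal_sublinear[OF shift_sublinear[OF nrm_sublinear x0]] by metis
  have add: "p (x + v) = p x + p v" if x: "x \<in> vecs X" and v: "v \<in> vecs X" for x v
  proof -
    \<comment> \<open>By t = 0, \<open>shift p v\<close> lies below \<open>p\<close>, so minimality
      applies; t = 1 then gives superadditivity.\<close>
    have "p x \<le> shift p v x"
      using shift_le[OF p v, of _ 0] v x
      by (intro min shift_sublinear p) auto
    also have "\<dots> \<le> p (x + v) - p v" using shift_le[OF p v x, of 1] v by (simp add: scl_one)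
    finally show ?thesis using sublinear_add[OF p x v] by simp
  qed
  have neg: "p (- x) = - p x" if "x \<in> vecs X" for x
    using add[OF that minus_closed[OF that]] sublinear_zero[OF p] by simp
  show thesis
  proof (rule that)
    show "p (x + y) = p x + p y" if "x \<in> vecs X" "y \<in> vecs X" for x y by (rule add[OF that])
    show "p (scl X (of_real t) x) = t * p x" if x: "x \<in> vecs X" for t x
    proof (cases "t \<ge> 0")
      case True
      then show ?thesis using sublinear_scl_eq[OF p x] by simp
    next
      case False
      have "scl X (of_real t) x = - scl X (of_real (- t)) x"
        using scl_scl[of "-1" "of_real (- t)" x] x
        by (simp flip: scl_neg_one add: scl_closed del: of_real_minus) simp
      then show ?thesis using sublinear_scl_eq[OF p x, of "- t"] False x
        by (simp add: neg scl_closed del: of_real_minus)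
    qed
    show "p x \<le> nrm X x" if x: "x \<in> vecs X" for x
      using le[OF x] shift_le[OF nrm_sublinear x0 x, of 0] x0 by simp
    have "p (- x0) \<le> - nrm X x0"
      using le[of "- x0"] shift_le[OF nrm_sublinear x0, of "- x0" 1] x0
      by (simp add: minus_closed scl_one)
    then show "nrm X x0 \<le> p x0" using neg[OF x0] by simp
  qed
qed

section \<open>Bounded functionals and the dual unit ball\<close>

lemma dual_bounded:
  assumes \<phi>: "\<phi> \<in> dual K X"
  obtains c where "c \<ge> 0" "\<And>x. x \<in> vecs X \<Longrightarrow> norm (\<phi> x) \<le> c * nrm X x"
proof -
  have lin: "\<phi> (scl X c x) = c * \<phi> x" if "c \<in> K" "x \<in> vecs X" for c x
    using \<phi> that by (auto simp: dual_def)
  have zero: "\<phi> 0 = 0" using lin[of 0 0] zero_closed by simp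
  obtain d where d: "d > 0" "\<And>y. y \<in> vecs X \<Longrightarrow> nrm X y < d \<Longrightarrow> norm (\<phi> y) < 1"
  proof -
    have "\<exists>d>0. \<forall>y\<in>vecs X. nrm X (y - 0) < d \<longrightarrow> norm (\<phi> y - \<phi> 0) < 1"
      using \<phi> zero_closed zero_less_one unfolding dual_def by blast
    then show ?thesis using that zero by auto
  qed
  show thesis
  \<comment> \<open>A vector scaled to norm d/2 lies strictly inside the d-ball, where the
    functional is below 1 in modulus.\<close>
  proof (rule that[of "2 / d"])
    fix x assume x: "x \<in> vecs X"
    show "norm (\<phi> x) \<le> 2 / d * nrm X x"
    proof (cases "nrm X x = 0")
      case True
      then show ?thesis using nrm_definite[OF x] zero by simp
    next
      case False
      then have pos: "nrm X x > 0" using nrm_nonneg[OF x] by simp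
      define t where "t = d / (2 * nrm X x)"
      have t: "t > 0" using d pos by (simp add: t_def)
      have "nrm X (scl X (of_real t) x) = t * nrm X x" using t x by (simp add: nrm_scl)
      also have "\<dots> < d" using pos d by (simp add: t_def)
      finally have "norm (\<phi> (scl X (of_real t) x)) < 1" using d x by (auto intro: scl_closed)
      then have "t * norm (\<phi> x) < 1" using t x by (simp add: lin norm_mult)
      then show ?thesis using pos d by (simp add: t_def field_simps)
    qed
  qed (use d in auto)
qed

text \<open>The bound on \<open>dual_norm\<close> becomes pointwise by normalising vectors, once
  continuity shows that its \<open>SUP\<close> is over a bounded set; conversely the pointwise bound
  gives continuity with d = e. The pointwise form is the one used afterwards.\<close>

lemma dual_ball_iff:
  "\<phi> \<in> dual_ball K X \<longleftrightarrow> 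
    (\<forall>x\<in>vecs X. \<phi> x \<in> K) \<and>
    (\<forall>x\<in>vecs X. \<forall>y\<in>vecs X. \<phi> (x + y) = \<phi> x + \<phi> y) \<and>
    (\<forall>c\<in>K. \<forall>x\<in>vecs X. \<phi> (scl X c x) = c * \<phi> x) \<and>
    (\<forall>x\<in>vecs X. norm (\<phi> x) \<le> nrm X x)" (is "_ \<longleftrightarrow> ?K \<and> ?add \<and> ?scl \<and> ?bd")
proof (intro iffI conjI)
  assume \<phi>: "\<phi> \<in> dual_ball K X"
  then show ?K ?add and scl: ?scl by (auto simp: dual_ball_def dual_def)
  show ?bd
  proof
    fix x assume x: "x \<in> vecs X"
    obtain c where c: "c \<ge> 0" "\<And>x. x \<in> vecs X \<Longrightarrow> norm (\<phi> x) \<le> c * nrm X x"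
      using \<phi> dual_bounded by (auto simp: dual_ball_def)
    have le1: "norm (\<phi> y) \<le> 1" if y: "y \<in> vecs X" "nrm X y \<le> 1" for y
    proof -
      have "bdd_above ((\<lambda>x. norm (\<phi> x)) ` {x \<in> vecs X. nrm X x \<le> 1})"
        using c by (auto intro!: bdd_aboveI[of _ c]) (meson mult_left_le order_trans)
      then have "norm (\<phi> y) \<le> dual_norm X \<phi>"
        unfolding dual_norm_def using y by (intro cSUP_upper) auto
      then show ?thesis using \<phi> by (simp add: dual_ball_def)
    qed
    show "norm (\<phi> x) \<le> nrm X x"
    proof (cases "nrm X x = 0")
      case True
      then show ?thesis using c(2)[OF x] by simp
    next
      case False
      then have pos: "nrm X x > 0" using nrm_nonneg[OF x] by simp
      have "norm (\<phi> (scl X (of_real (1 / nrm X x)) x)) \<le> 1"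
        using x pos nrm_scl[of "of_real (1 / nrm X x)" x]
        by (intro le1) (auto intro: scl_closed simp del: of_real_divide)
      then have "norm (of_real (1 / nrm X x) * \<phi> x) \<le> 1"
        using scl x by (metis of_real_K)
      then show ?thesis using pos by (simp add: norm_mult field_simps norm_divide)
    qed
  qed
next
  assume *: "?K \<and> ?add \<and> ?scl \<and> ?bd"
  have "\<phi> \<in> dual K X"
    unfolding dual_def
  proof (intro CollectI conjI ballI allI impI)
    fix x and e :: real assume x: "x \<in> vecs X" and "e > 0"
    have "norm (\<phi> y - \<phi> x) \<le> nrm X (y - x)" if y: "y \<in> vecs X" for y
    proof -
      have "\<phi> (y - x + x) = \<phi> (y - x) + \<phi> x" using * diff_closed x y by blast
      then have "\<phi> y - \<phi> x = \<phi> (y - x)" by simp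
      then show ?thesis using * diff_closed x y by simp
    qed
    then show "\<exists>d>0. \<forall>y\<in>vecs X. nrm X (y - x) < d \<longrightarrow> norm (\<phi> y - \<phi> x) < e"
      using \<open>e > 0\<close> by (intro exI[of _ e]) force
  qed (use * in auto)
  moreover have "dual_norm X \<phi> \<le> 1"
    unfolding dual_norm_def using * zero_closed
    by (intro cSUP_least) (auto intro: order_trans exI[of _ 0])
  ultimately show "\<phi> \<in> dual_ball K X" by (simp add: dual_ball_def)
qed

lemma dual_ball_subset_dual: "\<phi> \<in> dual_ball K X \<Longrightarrow> \<phi> \<in> dual K X"
  by (simp add: dual_ball_def)

lemma norming_functional:
  assumes x0: "x0 \<in> vecs X"
  obtains \<phi> where "\<phi> \<in> dual_ball K X" "nrm X x0 \<le> norm (\<phi> x0)"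
proof -
  obtain p where add: "\<And>x y. x \<in> vecs X \<Longrightarrow> y \<in> vecs X \<Longrightarrow> p (x + y) = p x + p y"
    and scl: "\<And>t x. x \<in> vecs X \<Longrightarrow> p (scl X (of_real t) x) = t * p x"
    and le: "\<And>x. x \<in> vecs X \<Longrightarrow> p x \<le> nrm X x" and ge: "nrm X x0 \<le> p x0"
    using norming_real_linear[OF x0] by metis
  from real_or_complex show thesis
  proof
    assume K: "K = \<real>"
    have "\<bar>p x\<bar> \<le> nrm X x" if x: "x \<in> vecs X" for x
    proof -
      have "p (- x) = - p x" using scl[OF x, of "-1"] scl_neg_one[OF x] by simp
      then show ?thesis using le[OF x] le[of "- x"] nrm_minus[OF x] minus_closed[OF x] by auto
    qed
    then have "(\<lambda>x. complex_of_real (p x)) \<in> dual_ball K X"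
      unfolding dual_ball_iff by (auto simp: K add scl elim!: Reals_cases)
    then show thesis using ge by (intro that[of "\<lambda>x. of_real (p x)"]) auto
  next
    assume K: "K = UNIV"
    \<comment> \<open>The complex functional with real part p, namely \<phi>(x) = p(x) - i
      p(ix).\<close>
    define \<phi> where "\<phi> x = Complex (p x) (- p (scl X \<i> x))" for x
    have split: "scl X c x = scl X (of_real (Re c)) x + scl X (of_real (Im c)) (scl X \<i> x)"
      if x: "x \<in> vecs X" for c x
    proof -
      have "scl X c x = scl X (of_real (Re c) + of_real (Im c) * \<i>) x"
        by (subst complex_eq[of c]) (simp add: mult.commute)
      then show ?thesis using x K by (simp only: scl_add_left scl_scl UNIV_I)
    qed
    have hom: "\<phi> (scl X c x) = c * \<phi> x" if x: "x \<in> vecs X" for c x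
    proof -
      have ix: "scl X \<i> x \<in> vecs X" using x K by (auto intro: scl_closed)
      have 1: "p (scl X c x) = Re c * p x + Im c * p (scl X \<i> x)"
        using x ix by (subst split[OF x]) (simp add: add scl scl_closed)
      have "scl X \<i> (scl X c x) = scl X (\<i> * c) x" using x K by (simp add: scl_scl)
      then have "p (scl X \<i> (scl X c x)) = Re c * p (scl X \<i> x) - Im c * p x"
        using x ix by (simp, subst split[OF x]) (simp add: add scl scl_closed del: of_real_minus)
      then show ?thesis using 1 by (simp add: \<phi>_def complex_eq_iff)
    qed
    have bd: "norm (\<phi> x) \<le> nrm X x" if x: "x \<in> vecs X" for x
    proof (cases "\<phi> x = 0")
      case True
      then show ?thesis using nrm_nonneg[OF x] by simp
    next
      case False
      \<comment> \<open>A rotation that makes the value of \<phi> real and nonnegative, so that the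
        bound on the real part p bounds the modulus.\<close>
      define \<theta> where "\<theta> = cnj (\<phi> x) / norm (\<phi> x)"
      have \<theta>: "norm \<theta> = 1" "\<theta> * \<phi> x = of_real (norm (\<phi> x))"
        using False complex_norm_square[of "\<phi> x"]
        by (auto simp: \<theta>_def norm_divide power2_eq_square field_simps)
      have "norm (\<phi> x) = Re (\<phi> (scl X \<theta> x))" using hom[OF x] \<theta> by simp
      also have "\<dots> = p (scl X \<theta> x)" by (simp add: \<phi>_def)
      also have "\<dots> \<le> nrm X x" using le[of "scl X \<theta> x"] x K \<theta> by (simp add: scl_closed nrm_scl)
      finally show ?thesis .
    qed
    have "\<phi> \<in> dual_ball K X"
      unfolding dual_ball_iff
    proof (intro conjI ballI)
      show "\<phi> (x + y) = \<phi> x + \<phi> y" if "x \<in> vecs X" "y \<in> vecs X" for x y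
        using that K by (simp add: \<phi>_def add scl_add_right scl_closed complex_eq_iff)
    qed (auto simp: hom bd K)
    moreover have "nrm X x0 \<le> norm (\<phi> x0)"
      using ge complex_Re_le_cmod[of "\<phi> x0"] by (simp add: \<phi>_def)
    ultimately show thesis by (rule that)
  qed
qed

end

context banach_RC begin

subsection \<open>Finiteness of the weak norms\<close>

lemma dual_ballD:
  assumes "\<phi> \<in> dual_ball K X"
  shows dual_ball_in: "x \<in> vecs X \<Longrightarrow> \<phi> x \<in> K"
    and dual_ball_add: "x \<in> vecs X \<Longrightarrow> y \<in> vecs X \<Longrightarrow> \<phi> (x + y) = \<phi> x + \<phi> y"
    and dual_ball_scl: "c \<in> K \<Longrightarrow> x \<in> vecs X \<Longrightarrow> \<phi> (scl X c x) = c * \<phi> x"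
    and dual_ball_bound: "x \<in> vecs X \<Longrightarrow> norm (\<phi> x) \<le> nrm X x"
  using assms unfolding dual_ball_iff by auto

lemma zero_in_dual_ball: "(\<lambda>_. 0) \<in> dual_ball K X"
  unfolding dual_ball_iff by (auto simp: nrm_nonneg)

lemma dual_diff:
  assumes "\<phi> \<in> dual K X" "x \<in> vecs X" "y \<in> vecs X"
  shows "\<phi> (x - y) = \<phi> x - \<phi> y"
proof -
  have "\<phi> (x - y + y) = \<phi> (x - y) + \<phi> y"
    using assms diff_closed[OF assms(2,3)] unfolding dual_def by blast
  then show ?thesis by simp
qed

lemma dual_zero: "\<phi> \<in> dual K X \<Longrightarrow> \<phi> 0 = 0"
  using dual_diff[of \<phi> 0 0] zero_closed by simp

lemma dual_scale:
  assumes "\<phi> \<in> dual_ball K X"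
  shows "(\<lambda>x. of_real c * \<phi> x) \<in> dual K X"
  unfolding dual_def
proof (intro CollectI conjI ballI allI impI)
  fix x and e :: real assume x: "x \<in> vecs X" and e: "e > 0"
  have "norm (of_real c * \<phi> y - of_real c * \<phi> x) < e"
    if y: "y \<in> vecs X" "nrm X (y - x) < e / (\<bar>c\<bar> + 1)" for y
  proof -
    have "norm (of_real c * \<phi> y - of_real c * \<phi> x) = \<bar>c\<bar> * norm (\<phi> (y - x))"
      using dual_diff[OF dual_ball_subset_dual[OF assms] y(1) x]
      by (simp add: norm_mult flip: right_diff_distrib)
    also have "\<dots> \<le> \<bar>c\<bar> * nrm X (y - x)"
      using dual_ball_bound[OF assms] diff_closed x y by (intro mult_left_mono) auto
    also have "\<dots> \<le> (\<bar>c\<bar> + 1) * nrm X (y - x)"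
      using nrm_nonneg diff_closed x y by (intro mult_right_mono) auto
    also have "\<dots> < e" using y(2) by (simp add: field_simps add_pos_nonneg)
    finally show ?thesis .
  qed
  then show "\<exists>d>0. \<forall>y\<in>vecs X. nrm X (y - x) < d \<longrightarrow>
      norm (of_real c * \<phi> y - of_real c * \<phi> x) < e"
    using e by (intro exI[of _ "e / (\<bar>c\<bar> + 1)"]) auto
qed (use dual_ballD[OF assms] in \<open>auto simp: mult_K algebra_simps\<close>)

text \<open>Completeness of the dual in the form needed: domination by \<open>b i * nrm X x\<close>
  gives pointwise convergence and the bound \<open>nrm X x\<close>, and closedness of
  \<open>K\<close> keeps the limits in \<open>K\<close>.\<close>

lemma dual_ball_series:
  assumes \<psi>: "\<And>i. \<psi> i \<in> dual_ball K X"
    and r: "\<And>i. \<bar>r i\<bar> \<le> b i" and b: "b sums 1"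
  shows "(\<lambda>x. \<Sum>i. of_real (r i) * \<psi> i x) \<in> dual_ball K X"
    and "x \<in> vecs X \<Longrightarrow> summable (\<lambda>i. of_real (r i) * \<psi> i x)"
proof -
  have le: "norm (of_real (r i) * \<psi> i x) \<le> b i * nrm X x" if "x \<in> vecs X" for i x
    using that r[of i] dual_ball_bound[OF \<psi> that]
    by (auto simp: norm_mult intro!: mult_mono order_trans[OF abs_ge_zero r])
  have sums: "(\<lambda>i. b i * nrm X x) sums nrm X x" for x
    using sums_mult2[OF b, of "nrm X x"] by simp
  have sm: "summable (\<lambda>i. of_real (r i) * \<psi> i x)" if "x \<in> vecs X" for x
    by (rule summable_comparison_test'[OF sums_summable[OF sums]]) (rule le[OF that])
  then show "x \<in> vecs X \<Longrightarrow> summable (\<lambda>i. of_real (r i) * \<psi> i x)" .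
  show "(\<lambda>x. \<Sum>i. of_real (r i) * \<psi> i x) \<in> dual_ball K X"
    unfolding dual_ball_iff
  proof (intro conjI ballI)
    fix x assume x: "x \<in> vecs X"
    have "(\<Sum>i<m. of_real (r i) * \<psi> i x) \<in> K" for m
      by (induction m) (auto intro!: add_K mult_K dual_ball_in[OF \<psi>] x)
    then show "(\<Sum>i. of_real (r i) * \<psi> i x) \<in> K"
      using closed_sequentially[OF closed_K _ summable_LIMSEQ[OF sm[OF x]]] by auto
    have "norm (\<Sum>i. of_real (r i) * \<psi> i x) \<le> (\<Sum>i. b i * nrm X x)"
      by (rule norm_suminf_le[OF le[OF x] sums_summable[OF sums]])
    then show "norm (\<Sum>i. of_real (r i) * \<psi> i x) \<le> nrm X x"
      using sums_unique[OF sums] by simp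
    fix y assume y: "y \<in> vecs X"
    show "(\<Sum>i. of_real (r i) * \<psi> i (x + y))
        = (\<Sum>i. of_real (r i) * \<psi> i x) + (\<Sum>i. of_real (r i) * \<psi> i y)"
      using x y by (subst suminf_add) (auto simp: sm dual_ball_add[OF \<psi>] algebra_simps)
  next
    fix c x assume c: "c \<in> K" and x: "x \<in> vecs X"
    have "(\<Sum>i. of_real (r i) * \<psi> i (scl X c x)) = (\<Sum>i. c * (of_real (r i) * \<psi> i x))"
      using c x by (simp add: dual_ball_scl[OF \<psi>] mult.left_commute)
    then show "(\<Sum>i. of_real (r i) * \<psi> i (scl X c x)) = c * (\<Sum>i. of_real (r i) * \<psi> i x)"
      using suminf_mult[OF sm[OF x]] by simp
  qed
qed

text \<open>For fixed \<open>x\<close> and \<open>m\<close> a seminorm in the functional. It is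
  defined for arbitrary functions, so partial sums of a series enter without a proof that they lie
  in the dual.\<close>

definition partial_l2 :: "(nat \<Rightarrow> 'a) \<Rightarrow> nat \<Rightarrow> ('a \<Rightarrow> complex) \<Rightarrow> real" where
  "partial_l2 x m \<phi> = L2_set (\<lambda>j. norm (\<phi> (x j))) {..<m}"

lemma partial_l2_add: "partial_l2 x m (\<lambda>z. f z + g z) \<le> partial_l2 x m f + partial_l2 x m g"
  unfolding partial_l2_def
  by (rule order_trans[OF L2_set_mono L2_set_triangle_ineq]) (auto simp: norm_triangle_ineq)

lemma partial_l2_scale: "partial_l2 x m (\<lambda>z. of_real c * f z) = \<bar>c\<bar> * partial_l2 x m f"
  unfolding partial_l2_def by (simp add: norm_mult L2_set_right_distrib)

text \<open>
  Gliding hump: if the bound fails, a series of functionals with coefficients \<open>\<plusminus>3 ^ -i\<close>, each term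
  nearly maximal for one of the seminorms and with the sign chosen so as not to cancel against
  the preceding partial sum, has unbounded partial_l2.
\<close>

lemma uniform_bound_dual_ball:
  assumes x: "\<And>j. x j \<in> vecs X"
    and pointwise: "\<And>\<phi>. \<phi> \<in> dual K X \<Longrightarrow> \<exists>B. \<forall>m. partial_l2 x m \<phi> \<le> B"
  shows "\<exists>B. \<forall>\<phi>\<in>dual_ball K X. \<forall>m. partial_l2 x m \<phi> \<le> B"
proof (rule ccontr)
  assume "\<not> ?thesis"
  then have unb: "\<exists>m. \<exists>\<phi>\<in>dual_ball K X. partial_l2 x m \<phi> > B" for B by (meson not_le)
  have partial_l2_nonneg: "0 \<le> partial_l2 x m f" for m f by (simp add: partial_l2_def)
  have "\<exists>m \<psi>. \<psi> \<in> dual_ball K X \<and> partial_l2 x m \<psi> > B \<and> (\<forall>\<xi>\<in>dual_ball K X. partial_l2 x m \<xi> \<le> 4/3 * partial_l2 x m \<psi>)"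
    if "B \<ge> 0" for B
  proof -
    obtain m \<phi>0 where \<phi>0: "\<phi>0 \<in> dual_ball K X" "partial_l2 x m \<phi>0 > B" using unb by blast
    define S where "S = (SUP \<xi>\<in>dual_ball K X. partial_l2 x m \<xi>)"
    have bdd: "bdd_above (partial_l2 x m ` dual_ball K X)"
      by (rule bdd_aboveI[of _ "L2_set (\<lambda>j. nrm X (x j)) {..<m}"])
        (auto simp: partial_l2_def intro!: L2_set_mono dual_ball_bound x)
    have up: "partial_l2 x m \<xi> \<le> S" if "\<xi> \<in> dual_ball K X" for \<xi>
      unfolding S_def using that bdd by (intro cSUP_upper)
    \<comment> \<open>One functional then exceeds B and also 3/4 of the supremum, whence the factor
      4/3. From B >= 0 follows S > 0, hence 3/4 * S < S.\<close>
    have "max B (3/4 * S) < S" using up[OF \<phi>0(1)] \<phi>0(2) that by auto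
    then obtain \<psi> where "\<psi> \<in> dual_ball K X" "max B (3/4 * S) < partial_l2 x m \<psi>"
      unfolding S_def using bdd \<phi>0(1) by (subst (asm) less_cSUP_iff) auto
    then show ?thesis using up by (intro exI[of _ m] exI[of _ \<psi>]) force
  qed
  \<comment> \<open>The threshold k * 3^k survives the coefficient 3^-k as k.\<close>
  then have "\<forall>k. \<exists>m \<psi>. \<psi> \<in> dual_ball K X \<and> partial_l2 x m \<psi> > real k * 3 ^ k \<and>
      (\<forall>\<xi>\<in>dual_ball K X. partial_l2 x m \<xi> \<le> 4/3 * partial_l2 x m \<psi>)" by simp
  then obtain m \<psi> where \<psi>: "\<And>k. \<psi> k \<in> dual_ball K X"
    and large: "\<And>k. partial_l2 x (m k) (\<psi> k) > real k * 3 ^ k"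
    and peak: "\<And>k \<xi>. \<xi> \<in> dual_ball K X \<Longrightarrow> partial_l2 x (m k) \<xi> \<le> 4/3 * partial_l2 x (m k) (\<psi> k)"
    by metis
  define sg where "sg k f = (if partial_l2 x (m k) (\<lambda>z. f z + of_real ((1/3) ^ k) * \<psi> k z)
      \<ge> partial_l2 x (m k) (\<lambda>z. f z + of_real (- ((1/3) ^ k)) * \<psi> k z) then 1 else - 1 :: real)" for k f
  define \<Phi> where "\<Phi> = rec_nat (\<lambda>_. 0) (\<lambda>k f z. f z + of_real (sg k f * (1/3) ^ k) * \<psi> k z)"
  define s where "s k = sg k (\<Phi> k)" for k
  have \<Phi>_Suc: "\<Phi> (Suc k) z = \<Phi> k z + of_real (s k * (1/3) ^ k) * \<psi> k z" for k z
    by (simp add: \<Phi>_def s_def)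
  have \<Phi>_sum: "\<Phi> k z = (\<Sum>i<k. of_real (s i * (1/3) ^ i) * \<psi> i z)" for k z
    by (induction k) (simp_all only: \<Phi>_Suc, simp_all add: \<Phi>_def)
  have s_abs: "\<bar>s k\<bar> = 1" for k by (simp add: s_def sg_def)
  \<comment> \<open>The two candidates for the next partial sum differ by
    \<open>2 * ?c * \<psi> k\<close>, so the larger of their seminorms, which \<open>sg\<close>
    selects, is at least that of \<open>?c * \<psi> k\<close>.\<close>
  have hump: "(1/3) ^ k * partial_l2 x (m k) (\<psi> k) \<le> partial_l2 x (m k) (\<Phi> (Suc k))" for k
  proof -
    let ?c = "(1/3) ^ k :: real" and ?q = "partial_l2 x (m k)"
    let ?a = "\<lambda>z. \<Phi> k z + of_real ?c * \<psi> k z" and ?b = "\<lambda>z. \<Phi> k z + of_real (- ?c) * \<psi> k z"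
    have "2 * ?c * ?q (\<psi> k) = ?q (\<lambda>z. of_real (2 * ?c) * \<psi> k z)" by (simp only: partial_l2_scale) simp
    also have "(\<lambda>z. of_real (2 * ?c) * \<psi> k z) = (\<lambda>z. ?a z + of_real (-1) * ?b z)"
      by (simp add: algebra_simps)
    also have "?q \<dots> \<le> ?q ?a + \<bar>-1\<bar> * ?q ?b"
      by (rule order_trans[OF partial_l2_add]) (simp only: partial_l2_scale order_refl)
    finally have "?c * ?q (\<psi> k) \<le> max (?q ?a) (?q ?b)" by simp
    moreover have "?q (\<Phi> (Suc k)) = max (?q ?a) (?q ?b)"
    proof (cases "?q ?a \<ge> ?q ?b")
      case True
      then have "\<Phi> (Suc k) = ?a" by (intro ext) (simp only: \<Phi>_Suc s_def sg_def if_True mult_1)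
      then show ?thesis using True by (simp only: max_absorb1)
    next
      case False
      then have "\<Phi> (Suc k) = ?b"
        by (intro ext) (simp only: \<Phi>_Suc s_def sg_def if_False mult_minus1)
      then show ?thesis using False by (simp only: max_absorb2 linear not_le less_imp_le)
    qed
    ultimately show ?thesis by simp
  qed
  \<comment> \<open>Coefficients of the tail from index k on, divided by 3/2 * 3^-k: their moduli
    sum to 1, so the normalised tail \<open>\<xi> k\<close> lies in the dual ball.\<close>
  define r where "r k i = s (i + k) * (2/3 * (1/3) ^ i)" for k i
  define \<xi> where "\<xi> k z = (\<Sum>i. of_real (r k i) * \<psi> (i + k) z)" for k z
  have geo: "(\<lambda>i. 2/3 * (1/3::real) ^ i) sums 1"
    using sums_mult[OF geometric_sums[of "1/3::real"], of "2/3"] by simp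
  have r_le: "\<bar>r k i\<bar> \<le> 2/3 * (1/3) ^ i" for k i by (simp add: r_def abs_mult s_abs)
  note series = dual_ball_series[of "\<lambda>i. \<psi> (i + k)" for k, OF \<psi> r_le geo]
  have \<xi>: "\<xi> k \<in> dual_ball K X" for k unfolding \<xi>_def[abs_def] by (rule series)
  \<comment> \<open>The moduli 3^-i sum to 3/2, so the full series is 3/2 times a member of the
    ball.\<close>
  define \<phi> where "\<phi> z = of_real (3/2) * \<xi> 0 z" for z
  have \<phi>_dual: "\<phi> \<in> dual K X" unfolding \<phi>_def[abs_def] by (rule dual_scale[OF \<xi>])
  have split: "\<phi> z = \<Phi> k z + of_real (3/2 * (1/3) ^ k) * \<xi> k z" if z: "z \<in> vecs X" for k z
  proof -
    let ?t = "\<lambda>i. of_real (r 0 i) * \<psi> (i + 0) z"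
    have "\<xi> 0 z = (\<Sum>i. ?t (i + k)) + (\<Sum>i<k. ?t i)"
      unfolding \<xi>_def by (rule suminf_split_initial_segment[OF series(2)[OF z]])
    also have "(\<Sum>i. ?t (i + k)) = of_real ((1/3) ^ k) * \<xi> k z"
      unfolding \<xi>_def by (subst suminf_mult[OF series(2)[OF z], symmetric])
        (simp add: r_def power_add mult_ac)
    finally show ?thesis
      by (simp add: \<phi>_def \<Phi>_sum r_def sum_distrib_left algebra_simps)
  qed
  obtain B where B: "\<And>m. partial_l2 x m \<phi> \<le> B" using pointwise[OF \<phi>_dual] by blast
  obtain k :: nat where k: "real k > 3 * B" using reals_Archimedean2 by blast
  let ?q = "partial_l2 x (m k)" and ?c = "(1/3) ^ k :: real"
  \<comment> \<open>The remainder after k + 1 terms has weight 3/2 * 3^-(k+1) = 1/2 * 3^-k.\<close>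
  have eq: "?q (\<Phi> (Suc k)) = ?q (\<lambda>z. \<phi> z + of_real (- (1/2 * ?c)) * \<xi> (Suc k) z)"
    unfolding partial_l2_def using x by (intro L2_set_cong refl) (simp add: split[of _ "Suc k"])
  have "?c * ?q (\<psi> k) \<le> ?q (\<Phi> (Suc k))" by (rule hump)
  also have "\<dots> \<le> ?q \<phi> + 1/2 * ?c * ?q (\<xi> (Suc k))"
    unfolding eq by (rule order_trans[OF partial_l2_add]) (simp only: partial_l2_scale, simp)
  \<comment> \<open>As \<open>\<psi> k\<close> is nearly maximal, the remainder takes away at most
    1/2 * 4/3 = 2/3 of the hump. The third that is left is at least k/3, which exceeds B.\<close>
  also have "\<dots> \<le> B + 1/2 * ?c * (4/3 * ?q (\<psi> k))"
    by (intro add_mono B mult_left_mono peak \<xi>) auto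
  also have "\<dots> = B + 2/3 * (?c * ?q (\<psi> k))" by simp
  finally have "1/3 * (?c * ?q (\<psi> k)) \<le> B" by linarith
  moreover have "?c * ?q (\<psi> k) \<ge> real k"
    using mult_left_mono[OF less_imp_le[OF large[of k]], of ?c] by (simp add: power_divide)
  ultimately show False using k by simp
qed

section \<open>The weak l_2 norm as a least upper bound of truncations\<close>

lemma vecs_weak_l2:
  "vecs (weak_lp K 2 X) = {x. (\<forall>j. x j \<in> vecs X) \<and>
    (\<forall>\<phi>\<in>dual K X. summable (\<lambda>j. (norm (\<phi> (x j)))\<^sup>2))}"
proof -
  have "\<phi> y \<in> K" if "\<phi> \<in> dual K X" "y \<in> vecs X" for \<phi> y
    using that by (auto simp: dual_def)
  then show ?thesis by (auto simp: weak_lp_def lp_space_def scalars_def)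
qed

lemma nrm_l2_scalars:
  assumes "summable (\<lambda>j. (norm (f j))\<^sup>2)"
  shows "nrm (lp_space 2 (scalars K)) f = sqrt (\<Sum>j. (norm (f j))\<^sup>2)"
  using suminf_nonneg[OF assms] by (simp add: lp_space_def scalars_def powr_half_sqrt)

lemma partial_l2_le_nrm:
  assumes "summable (\<lambda>j. (norm (\<phi> (x j)))\<^sup>2)"
  shows "partial_l2 x m \<phi> \<le> nrm (lp_space 2 (scalars K)) (\<lambda>j. \<phi> (x j))"
  unfolding nrm_l2_scalars[OF assms] partial_l2_def L2_set_def
  by (intro real_sqrt_le_mono sum_le_suminf assms) auto

lemma nrm_le_partial_l2_bound:
  assumes "summable (\<lambda>j. (norm (\<phi> (x j)))\<^sup>2)" and "\<And>m. partial_l2 x m \<phi> \<le> B"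
  shows "nrm (lp_space 2 (scalars K)) (\<lambda>j. \<phi> (x j)) \<le> B"
proof -
  have B: "0 \<le> B" using assms(2)[of 0] by (simp add: partial_l2_def)
  have "(\<Sum>j<m. (norm (\<phi> (x j)))\<^sup>2) \<le> B\<^sup>2" for m
    using power_mono[OF assms(2)[of m], of 2] by (simp add: partial_l2_def L2_set_def sum_nonneg)
  then have "(\<Sum>j. (norm (\<phi> (x j)))\<^sup>2) \<le> B\<^sup>2" by (intro suminf_le_const assms(1))
  then show ?thesis unfolding nrm_l2_scalars[OF assms(1)] using B by (rule real_le_lsqrt[rotated])
qed

text \<open>Here uniform boundedness enters: it makes the set behind the \<open>SUP\<close> bounded
  above, so that the weak norm dominates each of its members.\<close>

lemma partial_l2_le_weak_l2:
  assumes x: "x \<in> vecs (weak_lp K 2 X)" and \<phi>: "\<phi> \<in> dual_ball K X"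
  shows "partial_l2 x m \<phi> \<le> nrm (weak_lp K 2 X) x"
proof -
  have xj: "\<And>j. x j \<in> vecs X" and
    sm: "\<And>\<phi>. \<phi> \<in> dual K X \<Longrightarrow> summable (\<lambda>j. (norm (\<phi> (x j)))\<^sup>2)"
    using x by (auto simp: vecs_weak_l2)
  have "\<exists>B. \<forall>m. partial_l2 x m \<phi> \<le> B" if "\<phi> \<in> dual K X" for \<phi>
    using partial_l2_le_nrm[OF sm[OF that]] by blast
  then obtain B where B: "\<And>\<phi> m. \<phi> \<in> dual_ball K X \<Longrightarrow> partial_l2 x m \<phi> \<le> B"
    using uniform_bound_dual_ball[of x, OF xj] by metis
  have "bdd_above ((\<lambda>\<phi>. nrm (lp_space 2 (scalars K)) (\<lambda>j. \<phi> (x j))) ` dual_ball K X)"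
    using nrm_le_partial_l2_bound sm dual_ball_subset_dual B by (intro bdd_aboveI[of _ B]) blast
  then have "nrm (lp_space 2 (scalars K)) (\<lambda>j. \<phi> (x j)) \<le> nrm (weak_lp K 2 X) x"
    unfolding weak_lp_def using \<phi> by (auto intro: cSUP_upper)
  then show ?thesis
    using partial_l2_le_nrm[OF sm[OF dual_ball_subset_dual[OF \<phi>]], of m] by simp
qed

text \<open>With \<open>partial_l2_le_weak_l2\<close> this characterises the weak norm as a least
  upper bound; the zero functional keeps the supremum from being over an empty set.\<close>

lemma weak_l2_le:
  assumes x: "x \<in> vecs (weak_lp K 2 X)"
    and B: "\<And>\<phi> m. \<phi> \<in> dual_ball K X \<Longrightarrow> partial_l2 x m \<phi> \<le> B"
  shows "nrm (weak_lp K 2 X) x \<le> B"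
proof -
  have "nrm (lp_space 2 (scalars K)) (\<lambda>j. \<phi> (x j)) \<le> B" if "\<phi> \<in> dual_ball K X" for \<phi>
    using x B[OF that] dual_ball_subset_dual[OF that]
    by (intro nrm_le_partial_l2_bound) (auto simp: vecs_weak_l2)
  then show ?thesis unfolding weak_lp_def
    using zero_in_dual_ball by (auto intro!: cSUP_least)
qed

lemma weak_l2_nonneg: "x \<in> vecs (weak_lp K 2 X) \<Longrightarrow> 0 \<le> nrm (weak_lp K 2 X) x"
  using partial_l2_le_weak_l2[OF _ zero_in_dual_ball, of x 0] by (simp add: partial_l2_def)

lemma weak_l2_diff:
  assumes x: "x \<in> vecs (weak_lp K 2 X)" and y: "y \<in> vecs (weak_lp K 2 X)"
  shows "x - y \<in> vecs (weak_lp K 2 X)"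
proof -
  have "summable (\<lambda>j. (norm (\<phi> (x j - y j)))\<^sup>2)" if \<phi>: "\<phi> \<in> dual K X" for \<phi>
  proof (rule summable_comparison_test')
    show "summable (\<lambda>j. 2 * (norm (\<phi> (x j)))\<^sup>2 + 2 * (norm (\<phi> (y j)))\<^sup>2)"
      using x y \<phi> by (auto simp: vecs_weak_l2 intro!: summable_add summable_mult)
    fix j
    have "norm (\<phi> (x j - y j)) \<le> norm (\<phi> (x j)) + norm (\<phi> (y j))"
      using x y \<phi> by (subst dual_diff) (auto simp: vecs_weak_l2 norm_triangle_ineq4)
    then have "(norm (\<phi> (x j - y j)))\<^sup>2 \<le> (norm (\<phi> (x j)) + norm (\<phi> (y j)))\<^sup>2"
      by (rule power_mono) simp
    also have "\<dots> \<le> 2 * (norm (\<phi> (x j)))\<^sup>2 + 2 * (norm (\<phi> (y j)))\<^sup>2"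
      using sum_squares_bound[of "norm (\<phi> (x j))" "norm (\<phi> (y j))"]
      by (simp add: power2_sum)
    finally show "norm ((norm (\<phi> (x j - y j)))\<^sup>2)
        \<le> 2 * (norm (\<phi> (x j)))\<^sup>2 + 2 * (norm (\<phi> (y j)))\<^sup>2" by simp
  qed
  then show ?thesis using x y diff_closed by (auto simp: vecs_weak_l2)
qed

lemma weak_l2_triangle:
  assumes x: "x \<in> vecs (weak_lp K 2 X)" and y: "y \<in> vecs (weak_lp K 2 X)"
  shows "nrm (weak_lp K 2 X) y \<le> nrm (weak_lp K 2 X) x + nrm (weak_lp K 2 X) (y - x)"
proof (rule weak_l2_le[OF y])
  fix \<phi> m assume \<phi>: "\<phi> \<in> dual_ball K X"
  have "partial_l2 y m \<phi> \<le> partial_l2 x m \<phi> + partial_l2 (y - x) m \<phi>"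
    unfolding partial_l2_def
  proof (rule order_trans[OF L2_set_mono L2_set_triangle_ineq])
    fix j
    have "\<phi> (y j - x j) = \<phi> (y j) - \<phi> (x j)"
      using x y dual_ball_subset_dual[OF \<phi>] by (intro dual_diff) (auto simp: vecs_weak_l2)
    then show "norm (\<phi> (y j)) \<le> norm (\<phi> (x j)) + norm (\<phi> ((y - x) j))"
      using norm_triangle_ineq[of "\<phi> (x j)" "\<phi> (y j) - \<phi> (x j)"] by simp
  qed auto
  then show "partial_l2 y m \<phi> \<le> nrm (weak_lp K 2 X) x + nrm (weak_lp K 2 X) (y - x)"
    using partial_l2_le_weak_l2[OF x \<phi>, of m] partial_l2_le_weak_l2[OF weak_l2_diff[OF y x] \<phi>, of m] by simp
qed

lemma fin_family_weak_l2:
  assumes "\<And>j. j < m \<Longrightarrow> x j \<in> vecs X"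
  shows "fin_family m x \<in> vecs (weak_lp K 2 X)"
proof -
  have "summable (\<lambda>j. (norm (\<phi> (fin_family m x j)))\<^sup>2)" if "\<phi> \<in> dual K X" for \<phi>
    by (rule summable_finite[of "{..<m}"]) (auto simp: fin_family_def dual_zero[OF that])
  then show ?thesis using assms zero_closed by (auto simp: vecs_weak_l2 fin_family_def)
qed

text \<open>Unimodular factors leave each |\<phi>(x_j)| unchanged and truncation only drops terms.
  The choice of all factors equal to 1 gives plain truncation.\<close>

lemma weak_l2_fin_family_scl_le:
  assumes x: "x \<in> vecs (weak_lp K 2 X)" and \<theta>: "\<And>j. \<theta> j \<in> K" "\<And>j. norm (\<theta> j) = 1"
  shows "nrm (weak_lp K 2 X) (fin_family m (\<lambda>j. scl X (\<theta> j) (x j))) \<le> nrm (weak_lp K 2 X) x"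
proof (rule weak_l2_le)
  have xj: "x j \<in> vecs X" for j using x by (auto simp: vecs_weak_l2)
  then show "fin_family m (\<lambda>j. scl X (\<theta> j) (x j)) \<in> vecs (weak_lp K 2 X)"
    by (intro fin_family_weak_l2 scl_closed \<theta>)
  fix \<phi> l assume \<phi>: "\<phi> \<in> dual_ball K X"
  have "partial_l2 (fin_family m (\<lambda>j. scl X (\<theta> j) (x j))) l \<phi> \<le> partial_l2 x l \<phi>"
    unfolding partial_l2_def using dual_zero[OF dual_ball_subset_dual[OF \<phi>]]
    by (intro L2_set_mono) (auto simp: fin_family_def dual_ball_scl[OF \<phi> \<theta>(1) xj] norm_mult \<theta>(2))
  then show "partial_l2 (fin_family m (\<lambda>j. scl X (\<theta> j) (x j))) l \<phi> \<le> nrm (weak_lp K 2 X) x"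
    using partial_l2_le_weak_l2[OF x \<phi>, of l] by simp
qed

lemma weak_l2_fin_family_le:
  assumes "x \<in> vecs (weak_lp K 2 X)"
  shows "nrm (weak_lp K 2 X) (fin_family m x) \<le> nrm (weak_lp K 2 X) x"
proof -
  have "fin_family m (\<lambda>j. scl X 1 (x j)) = fin_family m x"
    using assms by (auto simp: fin_family_def vecs_weak_l2 scl_one)
  then show ?thesis using weak_l2_fin_family_scl_le[OF assms, of "\<lambda>_. 1" m] by simp
qed

section \<open>Weak l_1 norms of finite families\<close>

lemma sum_le_weak_l1:
  assumes x: "\<And>j. j < m \<Longrightarrow> x j \<in> vecs X" and \<phi>: "\<phi> \<in> dual_ball K X"
  shows "(\<Sum>j<m. norm (\<phi> (x j))) \<le> nrm (weak_lp K 1 X) (fin_family m x)"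
proof -
  have eq: "nrm (lp_space 1 (scalars K)) (\<lambda>j. \<phi> (fin_family m x j)) = (\<Sum>j<m. norm (\<phi> (x j)))"
    if "\<phi> \<in> dual_ball K X" for \<phi>
  proof -
    have "(\<Sum>j. norm (\<phi> (fin_family m x j))) = (\<Sum>j<m. norm (\<phi> (fin_family m x j)))"
      by (rule suminf_finite)
        (auto simp: fin_family_def dual_zero[OF dual_ball_subset_dual[OF that]])
    then show ?thesis by (simp add: lp_space_def scalars_def fin_family_def sum_nonneg)
  qed
  \<comment> \<open>The sum of the norms bounds the set, the family being finite.\<close>
  have "bdd_above ((\<lambda>\<phi>. \<Sum>j<m. norm (\<phi> (x j))) ` dual_ball K X)"
    by (rule bdd_aboveI[of _ "\<Sum>j<m. nrm X (x j)"])
      (auto intro!: sum_mono dual_ball_bound x)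
  then show ?thesis
    using \<phi> by (simp add: weak_lp_def eq cong: SUP_cong_simp) (rule cSUP_upper)
qed

lemma nrm_signed_sum_le_weak_l1:
  assumes x: "\<And>j. j < m \<Longrightarrow> x j \<in> vecs X" and \<sigma>: "\<And>j. \<bar>\<sigma> j\<bar> \<le> 1"
  shows "nrm X (\<Sum>j<m. scl X (of_real (\<sigma> j)) (x j)) \<le> nrm (weak_lp K 1 X) (fin_family m x)"
proof -
  have closed: "(\<Sum>j<l. scl X (of_real (\<sigma> j)) (x j)) \<in> vecs X" if "l \<le> m" for l
    using that x by (intro sum_closed scl_closed) auto
  obtain \<phi> where \<phi>: "\<phi> \<in> dual_ball K X"
    and le: "nrm X (\<Sum>j<m. scl X (of_real (\<sigma> j)) (x j))
      \<le> norm (\<phi> (\<Sum>j<m. scl X (of_real (\<sigma> j)) (x j)))"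
    using norming_functional[OF closed] by blast
  have "\<phi> (\<Sum>j<l. scl X (of_real (\<sigma> j)) (x j)) = (\<Sum>j<l. of_real (\<sigma> j) * \<phi> (x j))"
    if "l \<le> m" for l using that
    by (induction l) (simp_all add: dual_zero[OF dual_ball_subset_dual[OF \<phi>]]
        dual_ball_add[OF \<phi>] dual_ball_scl[OF \<phi>] closed scl_closed x)
  then have "norm (\<phi> (\<Sum>j<m. scl X (of_real (\<sigma> j)) (x j))) \<le> (\<Sum>j<m. norm (of_real (\<sigma> j) * \<phi> (x j)))"
    by (simp add: sum_norm_le)
  also have "\<dots> \<le> (\<Sum>j<m. norm (\<phi> (x j)))"
    using \<sigma> by (intro sum_mono) (auto simp: norm_mult mult_left_le_one_le)
  also have "\<dots> \<le> nrm (weak_lp K 1 X) (fin_family m x)" by (rule sum_le_weak_l1[OF x \<phi>])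
  finally show ?thesis using le by simp
qed

end

subsection \<open>Averages over signs\<close>

text \<open>Vanishing from m on makes this a finite set of total functions, closed under pointwise
  multiplication.\<close>

definition signs :: "nat \<Rightarrow> (nat \<Rightarrow> real) set" where
  "signs m = {\<sigma>. (\<forall>j<m. \<sigma> j = 1 \<or> \<sigma> j = -1) \<and> (\<forall>j\<ge>m. \<sigma> j = 0)}"

definition sign_avg :: "nat \<Rightarrow> ((nat \<Rightarrow> real) \<Rightarrow> 'b::real_vector) \<Rightarrow> 'b" where
  "sign_avg m f = (\<Sum>\<sigma>\<in>signs m. f \<sigma>) /\<^sub>R 2 ^ m"

lemma signs_0: "signs 0 = {\<lambda>_. 0}"
  by (auto simp: signs_def)

text \<open>The new sign is put in front, to match the doubling of t, which shifts the Rademacher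
  functions by one index.\<close>

lemma signs_Suc: "signs (Suc m) = case_nat 1 ` signs m \<union> case_nat (-1) ` signs m" (is "?L = ?R")
proof
  show "?L \<subseteq> ?R"
  proof
    fix \<sigma> assume \<sigma>: "\<sigma> \<in> ?L"
    have "\<sigma> = case_nat (\<sigma> 0) (\<sigma> \<circ> Suc)" by (auto split: nat.split)
    moreover have "\<sigma> \<circ> Suc \<in> signs m" "\<sigma> 0 = 1 \<or> \<sigma> 0 = -1" using \<sigma> by (auto simp: signs_def)
    ultimately show "\<sigma> \<in> ?R" by (metis UnCI imageI)
  qed
  have "case_nat c \<sigma> \<in> ?L" if "c = 1 \<or> c = -1" "\<sigma> \<in> signs m" for c \<sigma>
    unfolding signs_def
  proof (intro CollectI conjI allI impI)
    show "case_nat c \<sigma> j = 1 \<or> case_nat c \<sigma> j = -1" if "j < Suc m" for j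
      using that \<open>c = 1 \<or> c = -1\<close> \<open>\<sigma> \<in> signs m\<close> by (cases j) (auto simp: signs_def)
    show "case_nat c \<sigma> j = 0" if "Suc m \<le> j" for j
      using that \<open>\<sigma> \<in> signs m\<close> by (cases j) (auto simp: signs_def)
  qed
  then show "?R \<subseteq> ?L" by blast
qed

lemma finite_signs: "finite (signs m)"
  by (induction m) (simp_all add: signs_0 signs_Suc)

lemma inj_case_nat: "inj_on (case_nat c) A"
  by (intro inj_onI ext) (metis old.nat.simps(5))

lemma signs_Suc_disjoint: "case_nat (1::real) ` A \<inter> case_nat (-1) ` B = {}"
  by (auto dest: fun_cong[of _ _ 0])

lemma sign_avg_0: "sign_avg 0 f = f (\<lambda>_. 0)"
  by (simp add: sign_avg_def signs_0)

lemma sign_avg_Suc: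
  "sign_avg (Suc m) f = (sign_avg m (\<lambda>\<sigma>. f (case_nat 1 \<sigma>)) + sign_avg m (\<lambda>\<sigma>. f (case_nat (-1) \<sigma>))) /\<^sub>R 2"
  by (simp add: sign_avg_def signs_Suc sum.union_disjoint[OF _ _ signs_Suc_disjoint] finite_signs
      sum.reindex inj_case_nat scaleR_add_right)

lemma sign_avg_sum: "sign_avg m (\<lambda>\<sigma>. \<Sum>a\<in>S. f a \<sigma>) = (\<Sum>a\<in>S. sign_avg m (f a))"
  unfolding sign_avg_def by (subst sum.swap) (simp add: scaleR_sum_right)

lemma sign_avg_mult_left: "sign_avg m (\<lambda>\<sigma>. c * f \<sigma>) = c * sign_avg m f"
  for c :: "'b::real_algebra"
  unfolding sign_avg_def by (simp add: sum_distrib_left)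

lemma sign_avg_minus: "sign_avg m (\<lambda>\<sigma>. - f \<sigma>) = - sign_avg m f"
  unfolding sign_avg_def by (simp add: sum_negf)

lemma sign_avg_mult_right: "sign_avg m (\<lambda>\<sigma>. f \<sigma> * c) = sign_avg m f * c"
  for c :: "'b::real_algebra"
  unfolding sign_avg_def by (simp add: sum_distrib_right)

lemma sign_avg_const: "sign_avg m (\<lambda>_. c) = c"
  by (induction m) (simp_all add: sign_avg_0 sign_avg_Suc flip: scaleR_2)

lemma sign_avg_mono:
  fixes f g :: "(nat \<Rightarrow> real) \<Rightarrow> real"
  shows "(\<And>\<sigma>. \<sigma> \<in> signs m \<Longrightarrow> f \<sigma> \<le> g \<sigma>) \<Longrightarrow> sign_avg m f \<le> sign_avg m g"
  unfolding sign_avg_def by (simp add: sum_mono)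

lemma sign_avg_nonneg:
  fixes f :: "(nat \<Rightarrow> real) \<Rightarrow> real"
  shows "(\<And>\<sigma>. \<sigma> \<in> signs m \<Longrightarrow> 0 \<le> f \<sigma>) \<Longrightarrow> 0 \<le> sign_avg m f"
  unfolding sign_avg_def by (simp add: sum_nonneg)

lemma norm_sign_avg_le:
  fixes f :: "(nat \<Rightarrow> real) \<Rightarrow> 'b::real_normed_vector"
  shows "norm (sign_avg m f) \<le> sign_avg m (\<lambda>\<sigma>. norm (f \<sigma>))"
  unfolding sign_avg_def by (simp add: norm_sum)

lemma sign_avg_L2_set: "sqrt (sign_avg m (\<lambda>\<sigma>. (f \<sigma>)\<^sup>2)) = L2_set f (signs m) / sqrt (2 ^ m)"
  by (simp add: sign_avg_def L2_set_def divide_inverse_commute real_sqrt_mult real_sqrt_inverse)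

lemma sign_avg_Cauchy_Schwarz:
  "sign_avg m (\<lambda>\<sigma>. f \<sigma> * g \<sigma>) \<le> sqrt (sign_avg m (\<lambda>\<sigma>. (f \<sigma>)\<^sup>2)) * sqrt (sign_avg m (\<lambda>\<sigma>. (g \<sigma>)\<^sup>2))"
proof -
  have "(\<Sum>\<sigma>\<in>signs m. f \<sigma> * g \<sigma>) \<le> L2_set f (signs m) * L2_set g (signs m)"
    by (rule order_trans[OF sum_mono L2_set_mult_ineq]) (simp flip: abs_mult)
  then show ?thesis
    unfolding sign_avg_L2_set by (simp add: sign_avg_def divide_simps)
qed

lemma sign_avg_triangle:
  "sqrt (sign_avg m (\<lambda>\<sigma>. (f \<sigma> + g \<sigma>)\<^sup>2)) \<le> sqrt (sign_avg m (\<lambda>\<sigma>. (f \<sigma>)\<^sup>2)) + sqrt (sign_avg m (\<lambda>\<sigma>. (g \<sigma>)\<^sup>2))"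
  unfolding sign_avg_L2_set
  using divide_right_mono[OF L2_set_triangle_ineq[of f g "signs m"], of "sqrt (2 ^ m)"]
  by (simp add: add_divide_distrib)

text \<open>Multiplication by a fixed sign vector is an involution of \<open>signs m\<close>; this
  is why products of signs from different slots keep their distribution.\<close>

lemma sign_avg_flip:
  assumes "\<And>j. j < m \<Longrightarrow> \<rho> j = 1 \<or> \<rho> j = -1"
  shows "sign_avg m (\<lambda>\<sigma>. f (\<lambda>j. \<sigma> j * \<rho> j)) = sign_avg m f"
proof -
  have "(\<Sum>\<sigma>\<in>signs m. f (\<lambda>j. \<sigma> j * \<rho> j)) = (\<Sum>\<sigma>\<in>signs m. f \<sigma>)"
  proof (rule sum.reindex_bij_witness[where i = "\<lambda>\<sigma> j. \<sigma> j * \<rho> j" and j = "\<lambda>\<sigma> j. \<sigma> j * \<rho> j"])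
    have sq: "\<rho> j * \<rho> j = 1" if "j < m" for j using assms[OF that] by auto
    have "(\<lambda>j. \<sigma> j * \<rho> j * \<rho> j) = \<sigma>" if "\<sigma> \<in> signs m" for \<sigma>
    proof
      fix j show "\<sigma> j * \<rho> j * \<rho> j = \<sigma> j"
        using that sq[of j] by (cases "j < m") (auto simp: signs_def mult.assoc)
    qed
    then show "(\<lambda>j. \<sigma> j * \<rho> j * \<rho> j) = \<sigma>" "(\<lambda>j. \<sigma> j * \<rho> j * \<rho> j) = \<sigma>"
      if "\<sigma> \<in> signs m" for \<sigma> using that by auto
    show "(\<lambda>j. \<sigma> j * \<rho> j) \<in> signs m" "(\<lambda>j. \<sigma> j * \<rho> j) \<in> signs m" if "\<sigma> \<in> signs m" for \<sigma>
      using that assms by (fastforce simp: signs_def)+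
  qed simp
  then show ?thesis by (simp add: sign_avg_def)
qed

lemma sign_avg_coordinate: "j < m \<Longrightarrow> sign_avg m (\<lambda>\<sigma>. \<sigma> j) = 0"
proof (induction m arbitrary: j)
  case (Suc m)
  then show ?case
    by (cases j) (simp_all add: sign_avg_Suc sign_avg_const)
qed simp

lemma sign_avg_orthogonal:
  "j < m \<Longrightarrow> a < m \<Longrightarrow> sign_avg m (\<lambda>\<sigma>. \<sigma> j * \<sigma> a) = (if j = a then 1 else 0)"
proof (induction m arbitrary: j a)
  case (Suc m)
  then show ?case
    by (cases j; cases a)
      (simp_all add: sign_avg_Suc sign_avg_const sign_avg_coordinate sign_avg_minus)
qed simp

section \<open>Rademacher functions as random signs\<close>

definition rad_vec :: "nat \<Rightarrow> real \<Rightarrow> nat \<Rightarrow> real" where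
  "rad_vec m t = (\<lambda>j. if j < m then rademacher (j + 1) t else 0)"

lemma rad_vec_Suc: "rad_vec (Suc m) t = case_nat (rademacher 1 t) (rad_vec m (2 * t))"
  by (auto simp: rad_vec_def rademacher_def mult_ac split: nat.split)

lemma rad_vec_periodic: "rad_vec m (t + 1) = rad_vec m t"
proof -
  have "sin (2 ^ (j + 1) * pi * (t + 1)) = sin (2 ^ (j + 1) * pi * t + 2 * real (2 ^ j) * pi)" for j
    by (simp add: algebra_simps)
  then have "sin (2 ^ (j + 1) * pi * (t + 1)) = sin (2 ^ (j + 1) * pi * t)" for j
    unfolding sin_add cos_2npi sin_2npi by simp
  then show ?thesis by (auto simp: rad_vec_def rademacher_def)
qed

lemma rademacher_measurable: "rademacher j \<in> borel_measurable borel"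
  unfolding rademacher_def[abs_def] sgn_if by measurable

text \<open>As \<open>g\<close> is arbitrary, measurability rests on \<open>rad_vec\<close> having
  finitely many values: the induction splits on the first one, which may also be 0.\<close>

lemma rad_vec_measurable:
  fixes g :: "(nat \<Rightarrow> real) \<Rightarrow> real"
  shows "(\<lambda>t. g (rad_vec m t)) \<in> borel_measurable borel"
proof (induction m arbitrary: g)
  case 0
  then show ?case by (simp add: rad_vec_def)
next
  case (Suc m)
  note [measurable] = rademacher_measurable
  have [measurable]: "(\<lambda>t. g (case_nat c (rad_vec m (2 * t)))) \<in> borel_measurable borel" for c
    by (rule measurable_compose[OF _ Suc.IH, of "\<lambda>t. 2 * t"]) measurable
  have "g (rad_vec (Suc m) t) = (if rademacher 1 t = 1 then g (case_nat 1 (rad_vec m (2 * t)))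
      else if rademacher 1 t = 0 then g (case_nat 0 (rad_vec m (2 * t)))
      else g (case_nat (-1) (rad_vec m (2 * t))))" for t
    by (auto simp: rad_vec_Suc rademacher_def sgn_if)
  then show ?case by simp
qed

text \<open>Self-similarity: dropping the first Rademacher function and doubling t gives the system
  back, so the halves of [0,1] correspond to the two parts in \<open>signs_Suc\<close>.\<close>

lemma has_integral_rad_vec:
  fixes g :: "(nat \<Rightarrow> real) \<Rightarrow> real"
  shows "has_bochner_integral lborel (\<lambda>t. indicator {0..1} t * g (rad_vec m t)) (sign_avg m g)"
proof (induction m arbitrary: g)
  case 0
  have "has_bochner_integral lborel (\<lambda>t. indicator {0..1::real} t *\<^sub>R g (\<lambda>_. 0)) (measure lborel {0..1::real} *\<^sub>R g (\<lambda>_. 0))"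
    by (rule has_bochner_integral_indicator) auto
  then show ?case by (simp add: rad_vec_def sign_avg_0)
next
  case (Suc m)
  let ?h = "\<lambda>c t. indicator {0..1} t * g (case_nat c (rad_vec m t)) :: real"
  \<comment> \<open>The substitution by b + 2t halves the integral; b = 0 serves the left half,
    where the first sign is 1, and b = -1 the right half, where it is -1.\<close>
  have half: "has_bochner_integral lborel (\<lambda>t. ?h c (b + 2 * t)) (sign_avg m (\<lambda>\<sigma>. g (case_nat c \<sigma>)) /\<^sub>R 2)" for c b
    using Suc.IH[of "\<lambda>\<sigma>. g (case_nat c \<sigma>)"]
    by (subst (asm) lborel_has_bochner_integral_real_affine_iff[of 2 _ _ b]) auto
  have sum: "has_bochner_integral lborel (\<lambda>t. ?h 1 (0 + 2 * t) + ?h (-1) (-1 + 2 * t)) (sign_avg (Suc m) g)"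
    unfolding sign_avg_Suc scaleR_add_right by (intro has_bochner_integral_add half)
  \<comment> \<open>The points 0, 1/2 and 1 form a null set; on the right half, periodicity replaces
    2t - 1 by 2t.\<close>
  have ae: "AE t in lborel. indicator {0..1} t * g (rad_vec (Suc m) t) = ?h 1 (0 + 2 * t) + ?h (-1) (-1 + 2 * t)"
    using AE_lborel_singleton[of 0] AE_lborel_singleton[of "1/2"] AE_lborel_singleton[of 1]
  proof eventually_elim
    case (elim t)
    have per: "rad_vec m (2 * t - 1) = rad_vec m (2 * t)" using rad_vec_periodic[of m "2 * t - 1"] by simp
    consider "t < 0" | "0 < t" "t < 1/2" | "1/2 < t" "t < 1" | "t > 1" using elim by linarith
    then show ?case
    proof cases
      case 2
      then have "sin (2 * pi * t) > 0" using sin_gt_zero[of "2 * pi * t"] by simp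
      then have "rademacher 1 t = 1" by (simp add: rademacher_def)
      then show ?thesis using 2 by (simp add: rad_vec_Suc)
    next
      case 3
      then have "sin (2 * pi * t) < 0" using sin_lt_zero[of "2 * pi * t"] by simp
      then have "rademacher 1 t = -1" by (simp add: rademacher_def)
      then show ?thesis using 3 by (simp add: rad_vec_Suc per)
    qed (simp_all add: indicator_def)
  qed
  have "(\<lambda>t. indicator {0..1} t * g (rad_vec (Suc m) t)) \<in> borel_measurable lborel"
    using rad_vec_measurable[of g "Suc m"] by simp
  then show ?case
    using sum has_bochner_integral_cong_AE[OF _ borel_measurable_has_bochner_integral[OF sum] ae] by blast
qed

text \<open>\<open>X\<close> is an arbitrary record, so the identity also applies to the
  \<open>mult_space\<close> in which A_k takes its values.\<close>

lemma L2_norm_rad_sum: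
  "L2_norm X (rad_sum X x m) =
    sqrt (sign_avg m (\<lambda>\<sigma>. (nrm X (\<Sum>j<m. scl X (of_real (\<sigma> j)) (x j)))\<^sup>2))"
proof -
  have "(\<Sum>j<m. scl X (of_real (rad_vec m t j)) (x j)) = rad_sum X x m t" for t
    by (simp add: rad_sum_def rad_vec_def)
  then show ?thesis
    using has_bochner_integral_integral_eq[OF has_integral_rad_vec[of
        "\<lambda>\<sigma>. (nrm X (\<Sum>j<m. scl X (of_real (\<sigma> j)) (x j)))\<^sup>2" m]]
    by (simp add: L2_norm_def set_lebesgue_integral_def)
qed

subsection \<open>The space Rad\<close>

lemma L2_norm_rad_sum_nonneg: "0 \<le> L2_norm X (rad_sum X x m)"
  unfolding L2_norm_rad_sum by (intro real_sqrt_ge_zero sign_avg_nonneg) simp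

context banach_RC begin

lemma signed_sum_closed:
  "(\<And>j. x j \<in> vecs X) \<Longrightarrow> (\<Sum>j\<in>J. scl X (of_real (\<sigma> j)) (x j)) \<in> vecs X"
  by (intro sum_closed scl_closed) auto

lemma L2_norm_rad_sum_add:
  assumes x: "\<And>j. x j \<in> vecs X" and y: "\<And>j. y j \<in> vecs X"
  shows "L2_norm X (rad_sum X (x + y) m) \<le> L2_norm X (rad_sum X x m) + L2_norm X (rad_sum X y m)"
proof -
  let ?S = "\<lambda>x \<sigma>. \<Sum>j<m. scl X (of_real (\<sigma> j)) (x j)"
  have "nrm X (?S (x + y) \<sigma>) \<le> nrm X (?S x \<sigma>) + nrm X (?S y \<sigma>)" for \<sigma>
  proof -
    have "?S (x + y) \<sigma> = ?S x \<sigma> + ?S y \<sigma>"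
      using x y by (simp add: scl_add_right sum.distrib)
    then show ?thesis
      using nrm_triangle[OF signed_sum_closed[of x] signed_sum_closed[of y]] x y by simp
  qed
  then have "L2_norm X (rad_sum X (x + y) m)
      \<le> sqrt (sign_avg m (\<lambda>\<sigma>. (nrm X (?S x \<sigma>) + nrm X (?S y \<sigma>))\<^sup>2))"
    unfolding L2_norm_rad_sum
    by (intro real_sqrt_le_mono sign_avg_mono power_mono nrm_nonneg signed_sum_closed)
      (auto simp: x y add_closed)
  also have "\<dots> \<le> L2_norm X (rad_sum X x m) + L2_norm X (rad_sum X y m)"
    unfolding L2_norm_rad_sum by (rule sign_avg_triangle)
  finally show ?thesis .
qed

lemma L2_norm_rad_sum_minus:
  assumes x: "\<And>j. x j \<in> vecs X"
  shows "L2_norm X (rad_sum X (- x) m) = L2_norm X (rad_sum X x m)"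
proof -
  have "scl X (of_real c) (- x j) = - scl X (of_real c) (x j)" for c j
    using scl_scl[of "of_real c" "-1" "x j"] scl_scl[of "-1" "of_real c" "x j"] x
    by (simp add: scl_neg_one scl_closed)
  then have "(\<Sum>j<m. scl X (of_real (\<sigma> j)) ((- x) j)) = - (\<Sum>j<m. scl X (of_real (\<sigma> j)) (x j))" for \<sigma>
    by (simp add: sum_negf)
  then show ?thesis using x by (simp add: L2_norm_rad_sum nrm_minus signed_sum_closed)
qed

lemma Rad_upper: "x \<in> vecs (Rad X) \<Longrightarrow> L2_norm X (rad_sum X x m) \<le> nrm (Rad X) x"
  unfolding Rad_def by (auto intro: cSUP_upper)

lemma Rad_le: "(\<And>m. L2_norm X (rad_sum X x m) \<le> B) \<Longrightarrow> nrm (Rad X) x \<le> B"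
  unfolding Rad_def by (auto intro: cSUP_least)

lemma Rad_nonneg: "x \<in> vecs (Rad X) \<Longrightarrow> 0 \<le> nrm (Rad X) x"
  using Rad_upper[of x 0] L2_norm_rad_sum_nonneg[of X x 0] by simp

lemma Rad_diff:
  assumes x: "x \<in> vecs (Rad X)" and y: "y \<in> vecs (Rad X)"
  shows "x - y \<in> vecs (Rad X)"
proof -
  have xj: "x j \<in> vecs X" and yj: "y j \<in> vecs X" for j using x y by (auto simp: Rad_def)
  have "L2_norm X (rad_sum X (x - y) m) \<le> nrm (Rad X) x + nrm (Rad X) y" for m
    using L2_norm_rad_sum_add[of x "- y" m] L2_norm_rad_sum_minus[of y m] xj yj
      Rad_upper[OF x, of m] Rad_upper[OF y, of m] by (simp add: minus_closed)
  then have "bdd_above (range (\<lambda>m. L2_norm X (rad_sum X (x - y) m)))"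
    by (intro bdd_aboveI[of _ "nrm (Rad X) x + nrm (Rad X) y"]) auto
  then show ?thesis using xj yj diff_closed by (simp add: Rad_def)
qed

lemma Rad_triangle:
  assumes x: "x \<in> vecs (Rad X)" and y: "y \<in> vecs (Rad X)"
  shows "nrm (Rad X) y \<le> nrm (Rad X) x + nrm (Rad X) (y - x)"
proof (rule Rad_le)
  fix m
  have xj: "x j \<in> vecs X" and yj: "y j \<in> vecs X" for j using x y by (auto simp: Rad_def)
  show "L2_norm X (rad_sum X y m) \<le> nrm (Rad X) x + nrm (Rad X) (y - x)"
    using L2_norm_rad_sum_add[of x "y - x" m] xj yj diff_closed
      Rad_upper[OF x, of m] Rad_upper[OF Rad_diff[OF y x], of m] by simp
qed

text \<open>The bound holds for each choice of signs, hence for the quadratic mean.\<close>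

lemma L2_norm_rad_sum_le_weak_l1:
  assumes x: "\<And>j. j < m \<Longrightarrow> x j \<in> vecs X"
  shows "L2_norm X (rad_sum X x m) \<le> nrm (weak_lp K 1 X) (fin_family m x)"
proof -
  let ?w = "nrm (weak_lp K 1 X) (fin_family m x)"
  have w: "0 \<le> ?w" using sum_le_weak_l1[OF x zero_in_dual_ball] by simp
  have "(nrm X (\<Sum>j<m. scl X (of_real (\<sigma> j)) (x j)))\<^sup>2 \<le> ?w\<^sup>2" if "\<sigma> \<in> signs m" for \<sigma>
  proof -
    have "\<bar>\<sigma> j\<bar> \<le> 1" for j using that by (cases "j < m") (auto simp: signs_def)
    then show ?thesis using x
      by (intro power_mono nrm_signed_sum_le_weak_l1 nrm_nonneg sum_closed scl_closed) auto
  qed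
  then have "L2_norm X (rad_sum X x m) \<le> sqrt (sign_avg m (\<lambda>_. ?w\<^sup>2))"
    unfolding L2_norm_rad_sum by (intro real_sqrt_le_mono sign_avg_mono)
  then show ?thesis using w by (simp add: sign_avg_const)
qed

text \<open>Expansion gives the terms \<sigma>_j \<sigma>_a S_j(y_a), whose mean survives only for a
  = j. The form depends on j so that it can carry the entries of the other slots.\<close>

lemma sum_eq_sign_avg:
  fixes S :: "nat \<Rightarrow> 'a \<Rightarrow> complex"
  assumes add: "\<And>j x z. j < m \<Longrightarrow> x \<in> vecs X \<Longrightarrow> z \<in> vecs X \<Longrightarrow> S j (x + z) = S j x + S j z"
    and scl: "\<And>j c x. j < m \<Longrightarrow> c \<in> K \<Longrightarrow> x \<in> vecs X \<Longrightarrow> S j (scl X c x) = c * S j x"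
    and y: "\<And>a. y a \<in> vecs X"
  shows "(\<Sum>j<m. S j (y j)) = sign_avg m (\<lambda>\<sigma>. \<Sum>j<m. of_real (\<sigma> j) *
    S j (\<Sum>a<m. scl X (of_real (\<sigma> a)) (y a)))"
proof -
  have zero: "S j 0 = 0" if "j < m" for j using scl[OF that, of 0 0] zero_closed by simp
  have expand: "S j (\<Sum>a<l. scl X (of_real (\<sigma> a)) (y a)) = (\<Sum>a<l. of_real (\<sigma> a) * S j (y a))"
    if "j < m" for \<sigma> j l
    using y by (induction l) (simp_all add: zero[OF that] add[OF that] scl[OF that] scl_closed signed_sum_closed)
  have orth: "sign_avg m (\<lambda>\<sigma>. complex_of_real (\<sigma> j) * of_real (\<sigma> a)) = (if j = a then 1 else 0)"
    if "j < m" "a < m" for j a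
  proof -
    have "sign_avg m (\<lambda>\<sigma>. complex_of_real (\<sigma> j) * of_real (\<sigma> a))
        = of_real (sign_avg m (\<lambda>\<sigma>. \<sigma> j * \<sigma> a))"
      by (simp add: sign_avg_def scaleR_conv_of_real)
    then show ?thesis by (simp add: sign_avg_orthogonal[OF that])
  qed
  have "sign_avg m (\<lambda>\<sigma>. \<Sum>j<m. of_real (\<sigma> j) * S j (\<Sum>a<m. scl X (of_real (\<sigma> a)) (y a)))
      = sign_avg m (\<lambda>\<sigma>. \<Sum>j<m. \<Sum>a<m. of_real (\<sigma> j) * of_real (\<sigma> a) * S j (y a))"
    by (simp add: expand sum_distrib_left mult.assoc)
  also have "\<dots> = (\<Sum>j<m. \<Sum>a<m. (if j = a then 1 else 0) * S j (y a))"
    by (simp add: sign_avg_sum sign_avg_mult_right orth)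
  also have "\<dots> = (\<Sum>j<m. S j (y j))"
    by (intro sum.cong refl) (simp add: if_distrib[of "\<lambda>x. x * _"] cong: if_cong)
  finally show ?thesis by simp
qed

end

subsection \<open>Multilinear forms\<close>

lemma tuples_upd: "x \<in> tuples I E \<Longrightarrow> v \<in> vecs (E i) \<Longrightarrow> x(i := v) \<in> tuples (insert i I) E"
  by (auto simp: tuples_def PiE_def extensional_def)

lemma tuples_in: "x \<in> tuples I E \<Longrightarrow> i \<in> I \<Longrightarrow> x i \<in> vecs (E i)"
  by (auto simp: tuples_def)

lemma restrict_tuples: "(\<And>i. i \<in> I \<Longrightarrow> x i \<in> vecs (E i)) \<Longrightarrow> restrict x I \<in> tuples I E"
  by (auto simp: tuples_def)

lemma multilinear_add:
  "multilinear K I E F T \<Longrightarrow> x \<in> tuples I E \<Longrightarrow> i \<in> I \<Longrightarrow> y \<in> vecs (E i) \<Longrightarrow> z \<in> vecs (E i)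
    \<Longrightarrow> T (x(i := y + z)) = T (x(i := y)) + T (x(i := z))"
  by (auto simp: multilinear_def)

lemma multilinear_scl:
  "multilinear K I E (scalars K) T \<Longrightarrow> x \<in> tuples I E \<Longrightarrow> i \<in> I \<Longrightarrow> y \<in> vecs (E i) \<Longrightarrow> c \<in> K
    \<Longrightarrow> T (x(i := scl (E i) c y)) = c * T (x(i := y))"
  by (auto simp: multilinear_def scalars_def)

lemma multilinear_scl_all:
  assumes T: "multilinear K I E (scalars K) T" and "finite I" and x: "x \<in> tuples I E"
    and E: "\<And>i. i \<in> I \<Longrightarrow> banach_RC K (E i)" and c: "\<And>i. i \<in> I \<Longrightarrow> c i \<in> K"
  shows "T (\<lambda>i\<in>I. scl (E i) (c i) (x i)) = (\<Prod>i\<in>I. c i) * T x"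
proof -
  have scl_in: "scl (E l) (c l) (x l) \<in> vecs (E l)" if "l \<in> I" for l
    using banach_over.scl_closed[OF banach_RC.axioms(1)[OF E[OF that]] c[OF that] tuples_in[OF x that]] .
  have "T (\<lambda>i. if i \<in> J then scl (E i) (c i) (x i) else x i) = (\<Prod>i\<in>J. c i) * T x" if "J \<subseteq> I" for J
    using finite_subset[OF that \<open>finite I\<close>] that
  proof (induction J rule: finite_induct)
    case (insert i J)
    let ?z = "\<lambda>l. if l \<in> J then scl (E l) (c l) (x l) else x l"
    have "?z \<in> tuples I E"
      unfolding tuples_def
    proof (rule PiE_I)
      show "?z l \<in> vecs (E l)" if "l \<in> I" for l
        using scl_in[OF that] tuples_in[OF x that] by simp
      show "?z l = undefined" if "l \<notin> I" for l
        using that insert.prems x by (auto simp: tuples_def PiE_def extensional_def)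
    qed
    then have "T (?z(i := scl (E i) (c i) (x i))) = c i * T (?z(i := x i))"
      using insert.prems x c by (intro multilinear_scl[OF T]) (auto intro: tuples_in)
    moreover have "?z(i := x i) = ?z" using insert.hyps by auto
    moreover have "?z(i := scl (E i) (c i) (x i)) =
        (\<lambda>l. if l \<in> insert i J then scl (E l) (c l) (x l) else x l)" by auto
    ultimately show ?case using insert by simp
  qed simp
  from this[of I] show ?thesis
    using x by (auto simp: tuples_def PiE_def extensional_def restrict_def if_distrib cong: if_cong)
qed

text \<open>\<open>B\<close> is absent from the conclusion: it makes the set behind
  \<open>op_norm\<close> bounded. All slots are normalised, unless one has norm 0; that slot is then
  0 and \<open>T x\<close> vanishes.\<close>

lemma multilinear_le_op_norm:
  assumes T: "multilinear K I E (scalars K) T" and I: "finite I" and x: "x \<in> tuples I E"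
    and E: "\<And>i. i \<in> I \<Longrightarrow> banach_RC K (E i)"
    and B: "\<And>x. x \<in> tuples I E \<Longrightarrow> (\<And>i. i \<in> I \<Longrightarrow> nrm (E i) (x i) \<le> 1) \<Longrightarrow> norm (T x) \<le> B"
  shows "norm (T x) \<le> op_norm I E (scalars K) T * (\<Prod>i\<in>I. nrm (E i) (x i))"
proof (cases "\<exists>i\<in>I. nrm (E i) (x i) = 0")
  case True
  then obtain i where i: "i \<in> I" "nrm (E i) (x i) = 0" by auto
  interpret Ei: banach_RC K "E i" by (rule E[OF i(1)])
  have "x i = 0" using Ei.nrm_definite[OF tuples_in[OF x i(1)] i(2)] .
  then have "T x = T (x(i := scl (E i) 0 0))" by (simp add: fun_upd_idem)
  also have "\<dots> = 0" using multilinear_scl[OF T x i(1) Ei.zero_closed Ei.zero_K] by simp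
  finally have "T x = 0" .
  moreover have "(\<Prod>i\<in>I. nrm (E i) (x i)) = 0" using I i by (intro prod_zero) auto
  ultimately show ?thesis by simp
next
  case False
  have pos: "nrm (E i) (x i) > 0" if "i \<in> I" for i
    using False banach_RC.nrm_nonneg[OF E[OF that] tuples_in[OF x that]] that by force
  let ?c = "\<lambda>i. complex_of_real (1 / nrm (E i) (x i))"
  let ?y = "\<lambda>i\<in>I. scl (E i) (?c i) (x i)"
  have y: "?y \<in> tuples I E"
    using banach_over.scl_closed[OF banach_RC.axioms(1)[OF E]] banach_RC.of_real_K[OF E] tuples_in[OF x]
    by (intro restrict_tuples) blast
  have y1: "nrm (E i) (?y i) \<le> 1" if i: "i \<in> I" for i
    using banach_over.nrm_scl[OF banach_RC.axioms(1)[OF E[OF i]] banach_RC.of_real_K[OF E[OF i]] tuples_in[OF x i]]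
      pos[OF i] i by (simp del: of_real_divide)
  have "bdd_above ((\<lambda>x. nrm (scalars K) (T x)) ` {x \<in> tuples I E. \<forall>i\<in>I. nrm (E i) (x i) \<le> 1})"
    using B by (auto simp: scalars_def intro!: bdd_aboveI[of _ B])
  then have "norm (T ?y) \<le> op_norm I E (scalars K) T"
    unfolding op_norm_def using y y1
    by (intro order_trans[OF _ cSUP_upper[of ?y]]) (auto simp: scalars_def)
  moreover have "T ?y = (\<Prod>i\<in>I. ?c i) * T x"
    by (rule multilinear_scl_all[OF T I x E banach_RC.of_real_K[OF E]])
  moreover have "norm (\<Prod>i\<in>I. ?c i) = 1 / (\<Prod>i\<in>I. nrm (E i) (x i))"
  proof -
    have "norm (\<Prod>i\<in>I. ?c i) = (\<Prod>i\<in>I. norm (?c i))" by (rule prod_norm[symmetric])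
    also have "\<dots> = (\<Prod>i\<in>I. 1 / nrm (E i) (x i))"
      using pos by (intro prod.cong refl) (auto simp: norm_divide less_imp_le)
    finally show ?thesis by (simp add: prod_dividef)
  qed
  ultimately have "1 / (\<Prod>i\<in>I. nrm (E i) (x i)) * norm (T x) \<le> op_norm I E (scalars K) T"
    by (metis norm_mult)
  moreover have "(\<Prod>i\<in>I. nrm (E i) (x i)) > 0" using pos by (rule prod_pos)
  ultimately show ?thesis by (simp add: field_simps)
qed

text \<open>Scaling every slot by d/2 brings the unit ball into the d-neighbourhood of the origin.
  The value at the origin stays in the bound, which also covers an empty index set.\<close>

lemma continuous_multilinear_bounded:
  assumes T: "multilinear K I E (scalars K) T" and cont: "continuous_map_on I E (scalars K) T"
    and I: "finite I" and E: "\<And>i. i \<in> I \<Longrightarrow> banach_RC K (E i)"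
  obtains B where "\<And>x. x \<in> tuples I E \<Longrightarrow> (\<And>i. i \<in> I \<Longrightarrow> nrm (E i) (x i) \<le> 1) \<Longrightarrow> norm (T x) \<le> B"
proof -
  let ?o = "\<lambda>i\<in>I. 0"
  have o: "?o \<in> tuples I E"
    using banach_over.zero_closed[OF banach_RC.axioms(1)[OF E]] by (rule restrict_tuples)
  obtain d where d: "d > 0" and
    near: "\<And>y. y \<in> tuples I E \<Longrightarrow> (\<And>i. i \<in> I \<Longrightarrow> nrm (E i) (y i) < d) \<Longrightarrow> norm (T y - T ?o) < 1"
  proof -
    obtain d where "d > 0" and
      *: "\<forall>y\<in>tuples I E. (\<forall>i\<in>I. nrm (E i) (y i - ?o i) < d) \<longrightarrow> nrm (scalars K) (T y - T ?o) < 1"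
      using cont o zero_less_one unfolding continuous_map_on_def by blast
    show ?thesis
    proof (rule that[OF \<open>d > 0\<close>])
      fix y assume "y \<in> tuples I E" "\<And>i. i \<in> I \<Longrightarrow> nrm (E i) (y i) < d"
      then show "norm (T y - T ?o) < 1" using *[rule_format, of y] by (simp add: scalars_def)
    qed
  qed
  let ?c = "complex_of_real (d / 2)"
  show thesis
  proof (rule that)
    fix x assume x: "x \<in> tuples I E" and x1: "\<And>i. i \<in> I \<Longrightarrow> nrm (E i) (x i) \<le> 1"
    let ?y = "\<lambda>i\<in>I. scl (E i) ?c (x i)"
    have y: "?y \<in> tuples I E"
      using banach_over.scl_closed[OF banach_RC.axioms(1)[OF E]] banach_RC.of_real_K[OF E] tuples_in[OF x]
      by (intro restrict_tuples) blast
    have "nrm (E i) (?y i) < d" if i: "i \<in> I" for i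
    proof -
      have "nrm (E i) (?y i) = d / 2 * nrm (E i) (x i)"
        using banach_over.nrm_scl[OF banach_RC.axioms(1)[OF E[OF i]] banach_RC.of_real_K[OF E[OF i]] tuples_in[OF x i]] i d
        by (simp del: of_real_divide)
      also have "\<dots> \<le> d / 2 * 1" using x1[OF i] d by (intro mult_left_mono) auto
      finally show ?thesis using d by simp
    qed
    then have "norm (T ?y - T ?o) < 1" using near y by blast
    then have "norm (T ?y) < norm (T ?o) + 1" using norm_triangle_ineq2[of "T ?y" "T ?o"] by linarith
    moreover have "T ?y = (\<Prod>i\<in>I. ?c) * T x"
      by (rule multilinear_scl_all[OF T I x E banach_RC.of_real_K[OF E]])
    ultimately have "(d / 2) ^ card I * norm (T x) < norm (T ?o) + 1"
      using d by (simp add: norm_mult norm_power norm_divide)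
    then show "norm (T x) \<le> (norm (T ?o) + 1) / (d / 2) ^ card I" using d by (simp add: field_simps)
  qed
qed

text \<open>
  One slot is averaged at a time. The signs this attaches to \<open>T j\<close> do not change the average of
  \<open>(N \<sigma>)\<^sup>2\<close>, so every further slot can be averaged with the same bound; with no slot at all there
  would be nothing to average N against.
\<close>

lemma multilinear_sum_le_sign_avg:
  fixes T :: "nat \<Rightarrow> (nat \<Rightarrow> 'a::ab_group_add) \<Rightarrow> complex"
  assumes "finite I" and "I \<noteq> {}" and "\<And>i. i \<in> I \<Longrightarrow> banach_RC K (E i)"
    and "\<And>j. j < m \<Longrightarrow> multilinear K I E (scalars K) (T j)"
    and "\<And>\<sigma> x. \<sigma> \<in> signs m \<Longrightarrow> x \<in> tuples I E \<Longrightarrow>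
      norm (\<Sum>j<m. of_real (\<sigma> j) * T j x) \<le> N \<sigma> * (\<Prod>i\<in>I. nrm (E i) (x i))"
    and "\<And>i j. i \<in> I \<Longrightarrow> y i j \<in> vecs (E i)"
  shows "norm (\<Sum>j<m. T j (\<lambda>i\<in>I. y i j)) \<le>
    sqrt (sign_avg m (\<lambda>\<sigma>. (N \<sigma>)\<^sup>2)) * (\<Prod>i\<in>I. L2_norm (E i) (rad_sum (E i) (y i) m))"
  using assms
proof (induction I arbitrary: T N rule: finite_ne_induct)
  case (singleton i)
  interpret Ei: banach_RC K "E i" using singleton.prems(1) by simp
  let ?Y = "\<lambda>\<sigma>. \<Sum>a<m. scl (E i) (of_real (\<sigma> a)) (y i a)"
  \<comment> \<open>Tuples are \<open>undefined\<close> off their index set, so a tuple with one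
    slot is an update of this function.\<close>
  let ?u = "(\<lambda>_. undefined) :: nat \<Rightarrow> 'a"
  have tup: "?u(i := v) \<in> tuples {i} E" if "v \<in> vecs (E i)" for v
    using that by (auto simp: tuples_def PiE_def extensional_def)
  have yi: "y i j \<in> vecs (E i)" for j using singleton.prems(4) by simp
  have Y: "?Y \<sigma> \<in> vecs (E i)" for \<sigma> by (rule Ei.signed_sum_closed[OF yi])
  have eq: "(\<lambda>l\<in>{i}. y l j) = ?u(i := y i j)" for j by (auto simp: restrict_def)
  have "(\<Sum>j<m. T j (?u(i := y i j))) = sign_avg m (\<lambda>\<sigma>. \<Sum>j<m. of_real (\<sigma> j) * T j (?u(i := ?Y \<sigma>)))"
  proof (rule Ei.sum_eq_sign_avg[where S = "\<lambda>j v. T j (?u(i := v))"])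
    show "T j (?u(i := x + z)) = T j (?u(i := x)) + T j (?u(i := z))"
      if "j < m" "x \<in> vecs (E i)" "z \<in> vecs (E i)" for j x z
      using multilinear_add[OF singleton.prems(2)[OF that(1)] tup[OF Ei.zero_closed] _ that(2,3)]
      by (simp only: fun_upd_upd singletonI)
    show "T j (?u(i := scl (E i) c x)) = c * T j (?u(i := x))"
      if "j < m" "c \<in> K" "x \<in> vecs (E i)" for j c x
      using multilinear_scl[OF singleton.prems(2)[OF that(1)] tup[OF Ei.zero_closed] _ that(3,2)]
      by (simp only: fun_upd_upd singletonI)
  qed (rule yi)
  then have "norm (\<Sum>j<m. T j (\<lambda>l\<in>{i}. y l j))
      \<le> sign_avg m (\<lambda>\<sigma>. norm (\<Sum>j<m. of_real (\<sigma> j) * T j (?u(i := ?Y \<sigma>))))"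
    unfolding eq by (simp only: norm_sign_avg_le)
  also have "\<dots> \<le> sign_avg m (\<lambda>\<sigma>. N \<sigma> * nrm (E i) (?Y \<sigma>))"
  proof (rule sign_avg_mono)
    fix \<sigma> assume \<sigma>: "\<sigma> \<in> signs m"
    have prod_eq: "(\<Prod>l\<in>{i}. nrm (E l) ((?u(i := v)) l)) = nrm (E i) v" for v by simp
    show "norm (\<Sum>j<m. of_real (\<sigma> j) * T j (?u(i := ?Y \<sigma>))) \<le> N \<sigma> * nrm (E i) (?Y \<sigma>)"
      using singleton.prems(3)[OF \<sigma> tup[OF Y]]
      unfolding prod_eq .
  qed
  also have "\<dots> \<le> sqrt (sign_avg m (\<lambda>\<sigma>. (N \<sigma>)\<^sup>2)) * L2_norm (E i) (rad_sum (E i) (y i) m)"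
    unfolding L2_norm_rad_sum by (rule sign_avg_Cauchy_Schwarz)
  finally show ?case
    by (simp only: prod.insert finite.emptyI prod.empty mult_1_right empty_iff not_False_eq_True)
next
  case (insert i I)
  interpret Ei: banach_RC K "E i" using insert.prems(1) by simp
  let ?Y = "\<lambda>\<sigma>. \<Sum>a<m. scl (E i) (of_real (\<sigma> a)) (y i a)"
  let ?u = "\<lambda>j. \<lambda>l\<in>I. y l j"
  let ?P = "\<Prod>l\<in>I. L2_norm (E l) (rad_sum (E l) (y l) m)"
  let ?M = "sqrt (sign_avg m (\<lambda>\<sigma>. (N \<sigma>)\<^sup>2))"
  have u: "?u j \<in> tuples I E" for j using insert.prems(4) by (intro restrict_tuples) simp
  have yi: "y i j \<in> vecs (E i)" for j using insert.prems(4) by simp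
  have Y: "?Y \<sigma> \<in> vecs (E i)" for \<sigma> by (rule Ei.signed_sum_closed[OF yi])
  have eq: "(\<lambda>l\<in>insert i I. y l j) = (?u j)(i := y i j)" for j by (auto simp: restrict_def)
  have P: "0 \<le> ?P" by (intro prod_nonneg L2_norm_rad_sum_nonneg ballI)
  have M: "0 \<le> ?M" by (intro real_sqrt_ge_zero sign_avg_nonneg) simp
  have "(\<Sum>j<m. T j ((?u j)(i := y i j)))
      = sign_avg m (\<lambda>\<sigma>. \<Sum>j<m. of_real (\<sigma> j) * T j ((?u j)(i := ?Y \<sigma>)))"
  proof (rule Ei.sum_eq_sign_avg[where S = "\<lambda>j v. T j ((?u j)(i := v))"])
    show "T j ((?u j)(i := x + z)) = T j ((?u j)(i := x)) + T j ((?u j)(i := z))"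
      if "j < m" "x \<in> vecs (E i)" "z \<in> vecs (E i)" for j x z
      using multilinear_add[OF insert.prems(2)[OF that(1)] tuples_upd[where i = i, OF u[of j] Ei.zero_closed] _ that(2,3)]
      by (simp only: fun_upd_upd insertI1)
    show "T j ((?u j)(i := scl (E i) c x)) = c * T j ((?u j)(i := x))"
      if "j < m" "c \<in> K" "x \<in> vecs (E i)" for j c x
      using multilinear_scl[OF insert.prems(2)[OF that(1)] tuples_upd[where i = i, OF u[of j] Ei.zero_closed] _ that(3,2)]
      by (simp only: fun_upd_upd insertI1)
  qed (rule yi)
  then have "norm (\<Sum>j<m. T j (\<lambda>l\<in>insert i I. y l j))
      \<le> sign_avg m (\<lambda>\<sigma>. norm (\<Sum>j<m. of_real (\<sigma> j) * T j ((?u j)(i := ?Y \<sigma>))))"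
    unfolding eq by (simp only: norm_sign_avg_le)
  also have "\<dots> \<le> sign_avg m (\<lambda>\<sigma>. ?M * ?P * nrm (E i) (?Y \<sigma>))"
  proof (rule sign_avg_mono)
    fix \<sigma> assume \<sigma>: "\<sigma> \<in> signs m"
    \<comment> \<open>Slot i is frozen at the signed sum for \<sigma>, and \<sigma>_j moves into the
      form. Inner signs \<rho>_j then meet \<sigma>_j as a product, so \<open>N'\<close> evaluates
      \<open>N\<close> at that product.\<close>
    define T' where "T' j x = of_real (\<sigma> j) * T j (x(i := ?Y \<sigma>))" for j x
    define N' where "N' \<rho> = N (\<lambda>j. \<rho> j * \<sigma> j) * nrm (E i) (?Y \<sigma>)" for \<rho>
    have "norm (\<Sum>j<m. T' j (?u j)) \<le> sqrt (sign_avg m (\<lambda>\<rho>. (N' \<rho>)\<^sup>2)) * ?P"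
    proof (rule insert.IH)
      fix j assume j: "j < m"
      have "T' j (x(l := a + b)) = T' j (x(l := a)) + T' j (x(l := b))"
        if "x \<in> tuples I E" "l \<in> I" "a \<in> vecs (E l)" "b \<in> vecs (E l)" for x l a b
      proof -
        have "l \<noteq> i" using that insert.hyps by auto
        note multilinear_add[OF insert.prems(2)[OF j]
            tuples_upd[where i = i, OF that(1) Y[of \<sigma>]] insertI2[OF that(2)] that(3,4)]
        then show ?thesis by (simp only: T'_def fun_upd_twist[OF \<open>l \<noteq> i\<close>] distrib_left)
      qed
      moreover have "T' j (x(l := scl (E l) c a)) = c * T' j (x(l := a))"
        if "x \<in> tuples I E" "l \<in> I" "a \<in> vecs (E l)" "c \<in> K" for x l a c
      proof -
        have "l \<noteq> i" using that insert.hyps by auto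
        note multilinear_scl[OF insert.prems(2)[OF j]
            tuples_upd[where i = i, OF that(1) Y[of \<sigma>]] insertI2[OF that(2)] that(3,4)]
        then show ?thesis by (simp only: T'_def fun_upd_twist[OF \<open>l \<noteq> i\<close>] mult.left_commute)
      qed
      ultimately show "multilinear K I E (scalars K) (T' j)"
        by (auto simp: multilinear_def scalars_def)
    next
      fix \<rho> x assume \<rho>: "\<rho> \<in> signs m" and x: "x \<in> tuples I E"
      have "(\<lambda>j. \<rho> j * \<sigma> j) \<in> signs m" using \<rho> \<sigma> by (fastforce simp: signs_def)
      from insert.prems(3)[OF this tuples_upd[OF x Y[of \<sigma>]]]
      have "norm (\<Sum>j<m. of_real (\<rho> j * \<sigma> j) * T j (x(i := ?Y \<sigma>)))
          \<le> N (\<lambda>j. \<rho> j * \<sigma> j) * (\<Prod>l\<in>insert i I. nrm (E l) ((x(i := ?Y \<sigma>)) l))" .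
      also have "(\<Prod>l\<in>insert i I. nrm (E l) ((x(i := ?Y \<sigma>)) l)) = nrm (E i) (?Y \<sigma>) * (\<Prod>l\<in>I. nrm (E l) (x l))"
      proof -
        have "l \<noteq> i" if "l \<in> I" for l using that insert.hyps by auto
        then have "(\<Prod>l\<in>I. nrm (E l) ((x(i := ?Y \<sigma>)) l)) = (\<Prod>l\<in>I. nrm (E l) (x l))"
          by (intro prod.cong refl) simp
        then show ?thesis by (simp only: prod.insert[OF insert.hyps(1,3)] fun_upd_same)
      qed
      finally show "norm (\<Sum>j<m. of_real (\<rho> j) * T' j x) \<le> N' \<rho> * (\<Prod>l\<in>I. nrm (E l) (x l))"
        by (simp only: T'_def N'_def of_real_mult mult.assoc)
    qed (use insert.prems in auto)
    \<comment> \<open>With \<sigma> fixed, \<open>sign_avg_flip\<close> removes it from the argument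
      of \<open>N\<close>.\<close>
    also have "sign_avg m (\<lambda>\<rho>. (N' \<rho>)\<^sup>2) = sign_avg m (\<lambda>\<rho>. (N \<rho>)\<^sup>2) * (nrm (E i) (?Y \<sigma>))\<^sup>2"
      unfolding N'_def power_mult_distrib sign_avg_mult_right
      using sign_avg_flip[of m \<sigma> "\<lambda>\<rho>. (N \<rho>)\<^sup>2"] \<sigma> by (simp add: signs_def)
    finally show "norm (\<Sum>j<m. of_real (\<sigma> j) * T j ((?u j)(i := ?Y \<sigma>))) \<le> ?M * ?P * nrm (E i) (?Y \<sigma>)"
      by (simp only: T'_def real_sqrt_mult real_sqrt_abs abs_of_nonneg[OF Ei.nrm_nonneg[OF Y]] mult_ac)
  qed
  \<comment> \<open>The factor 1 prepares Cauchy-Schwarz against a constant, which bounds the mean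
    norm in slot i by its quadratic mean.\<close>
  also have "\<dots> = ?M * ?P * sign_avg m (\<lambda>\<sigma>. 1 * nrm (E i) (?Y \<sigma>))"
    by (simp add: sign_avg_mult_left)
  also have "\<dots> \<le> ?M * ?P * (sqrt (sign_avg m (\<lambda>_. 1\<^sup>2)) * L2_norm (E i) (rad_sum (E i) (y i) m))"
    unfolding L2_norm_rad_sum[of "E i"] using P M by (intro mult_left_mono sign_avg_Cauchy_Schwarz) simp
  also have "\<dots> = ?M * (\<Prod>l\<in>insert i I. L2_norm (E l) (rad_sum (E l) (y l) m))"
    using insert.hyps by (simp add: sign_avg_const mult_ac)
  finally show ?case .
qed

subsection \<open>The induced mapping\<close>

text \<open>Addition in \<open>mult_space\<close> is that of functions; this links Rademacher sums
  there with sums of values of the forms.\<close>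

lemma sum_scl_mult_space:
  "(\<Sum>j\<in>J. scl (mult_space K I E (scalars K)) (c j) (T j)) x = (\<Sum>j\<in>J. c j * T j x)"
  by (induction J rule: infinite_finite_induct) (simp_all add: mult_space_def scalars_def)

text \<open>Stated outside the locale, for use in \<open>mult_space\<close>. Extension by 0 makes
  the partial sums stationary from m on, so the supremum is over a finite set.\<close>

lemma Rad_fin_family_upper:
  assumes "\<And>c. scl X c 0 = 0"
  shows "L2_norm X (rad_sum X x m) \<le> nrm (Rad X) (fin_family m x)"
proof -
  let ?f = "\<lambda>l. L2_norm X (rad_sum X (fin_family m x) l)"
  have stable: "rad_sum X (fin_family m x) l = rad_sum X x (min l m)" for l
  proof
    fix t
    have "(\<Sum>j<l. scl X (of_real (rademacher (j + 1) t)) (fin_family m x j))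
        = (\<Sum>j<min l m. scl X (of_real (rademacher (j + 1) t)) (x j))"
      using assms by (intro sum.mono_neutral_cong_right) (auto simp: fin_family_def)
    then show "rad_sum X (fin_family m x) l t = rad_sum X x (min l m) t" by (simp add: rad_sum_def)
  qed
  have "range ?f \<subseteq> (\<lambda>l. L2_norm X (rad_sum X x l)) ` {..m}"
    by (auto simp: stable)
  then have "finite (range ?f)" by (rule finite_subset) simp
  then have "?f m \<le> (SUP l. ?f l)" by (intro cSUP_upper bdd_above_finite) auto
  then show ?thesis by (simp add: stable Rad_def)
qed

text \<open>
  The unimodular factors \<open>\<theta> j\<close> turn \<open>\<bar>A\<bar>\<close> into A and are absorbed by the first slot, whose weak norm
  does not see them.
\<close>

lemma sum_norm_le_as_bound:
  fixes E :: "nat \<Rightarrow> 'a::ab_group_add nspace"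
  defines "F \<equiv> \<lambda>k n K. mult_space K {k+1..n} E (scalars K)"
  assumes "1 \<le> k" and "k < n"
    and E: "\<And>i. i \<in> {1..n} \<Longrightarrow> banach_RC K (E i)"
    and A_space: "A \<in> vecs (mult_space K {1..n} E (scalars K))"
    and Ak: "assoc_map k n E A \<in> vecs (mult_space K {1..k} E (F k n K))"
    and C: "C \<ge> 0" "as_bound K {1..k} E (F k n K) (assoc_map k n E A) C"
    and s: "\<And>i j. i \<in> {1..n} \<Longrightarrow> s i j \<in> vecs (E i)"
  shows "(\<Sum>j<m. norm (A (\<lambda>i\<in>{1..n}. s i j))) \<le>
    C * (\<Prod>i\<in>{1..k}. nrm (weak_lp K 2 (E i)) (fin_family m (s i)))
      * (\<Prod>i\<in>{k+1..n}. L2_norm (E i) (rad_sum (E i) (s i) m))"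
proof -
  let ?F = "F k n K" and ?B = "assoc_map k n E A"
  have A: "multilinear K {1..n} E (scalars K) A" and A_in: "\<And>x. x \<in> tuples {1..n} E \<Longrightarrow> A x \<in> K"
    using A_space by (auto simp: mult_space_def scalars_def)
  have one: "1 \<in> {1..n}" using assms(2,3) by simp
  interpret E1: banach_RC K "E 1" by (rule E[OF one])
  \<comment> \<open>The value 1 where A vanishes keeps every factor unimodular.\<close>
  define \<theta> where "\<theta> j = (let a = A (\<lambda>i\<in>{1..n}. s i j) in if a = 0 then 1 else cnj a / of_real (norm a))" for j
  have sj: "(\<lambda>i\<in>{1..n}. s i j) \<in> tuples {1..n} E" for j using s by (intro restrict_tuples)
  have \<theta>: "norm (\<theta> j) = 1" "\<theta> j \<in> K"
    "\<theta> j * A (\<lambda>i\<in>{1..n}. s i j) = of_real (norm (A (\<lambda>i\<in>{1..n}. s i j)))" for j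
  proof -
    define a where "a = A (\<lambda>i\<in>{1..n}. s i j)"
    have \<theta>_eq: "\<theta> j = (if a = 0 then 1 else cnj a / of_real (norm a))"
      by (simp add: \<theta>_def a_def Let_def)
    show "norm (\<theta> j) = 1" by (simp add: \<theta>_eq norm_divide)
    have "a \<in> K" using A_in[OF sj] by (simp add: a_def)
    then show "\<theta> j \<in> K"
      using E1.real_or_complex by (auto simp: \<theta>_eq Reals_cnj_iff[THEN iffD1] intro!: Reals_divide)
    show "\<theta> j * A (\<lambda>i\<in>{1..n}. s i j) = of_real (norm (A (\<lambda>i\<in>{1..n}. s i j)))"
      unfolding a_def[symmetric] \<theta>_eq using complex_norm_square[of a]
      by (simp add: power2_eq_square field_simps)
  qed
  define u where "u j = (\<lambda>i\<in>{1..k}. if i = 1 then scl (E 1) (\<theta> j) (s 1 j) else s i j)" for j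
  have u: "u j \<in> tuples {1..k} E" for j
    unfolding u_def
  proof (rule restrict_tuples)
    fix i assume "i \<in> {1..k}"
    then show "(if i = 1 then scl (E 1) (\<theta> j) (s 1 j) else s i j) \<in> vecs (E i)"
      using s[of i j] assms(3) E1.scl_closed[OF \<theta>(2) s[OF one], of j j] by (simp del: One_nat_def)
  qed
  define T where "T j = ?B (u j)" for j
  have "T j \<in> vecs ?F" for j using Ak u by (auto simp: T_def mult_space_def)
  then have T: "multilinear K {k+1..n} E (scalars K) (T j)"
    "continuous_map_on {k+1..n} E (scalars K) (T j)" for j
    by (auto simp: F_def mult_space_def)
  have TA: "T j (\<lambda>i\<in>{k+1..n}. s i j) = of_real (norm (A (\<lambda>i\<in>{1..n}. s i j)))" for j
  proof -
    let ?x = "\<lambda>i\<in>{1..n}. s i j"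
    have "(\<lambda>i\<in>{k+1..n}. s i j) \<in> tuples {k+1..n} E" using s by (intro restrict_tuples) auto
    then have "T j (\<lambda>i\<in>{k+1..n}. s i j) = A (merge {1..k} {k+1..n} (u j, \<lambda>i\<in>{k+1..n}. s i j))"
      using u by (simp add: T_def assoc_map_def)
    also have "merge {1..k} {k+1..n} (u j, \<lambda>i\<in>{k+1..n}. s i j) = ?x(1 := scl (E 1) (\<theta> j) (s 1 j))"
      using assms(2,3) by (auto simp: merge_def u_def restrict_def fun_eq_iff)
    also have "A \<dots> = \<theta> j * A (?x(1 := s 1 j))"
      by (rule multilinear_scl[OF A sj one s[OF one] \<theta>(2)])
    also have "?x(1 := s 1 j) = ?x" using one by (auto simp: fun_eq_iff)
    finally show ?thesis by (simp only: \<theta>(3))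
  qed
  \<comment> \<open>Defined through the sum in \<open>?F\<close>, so that its quadratic mean is the
    \<open>L2_norm\<close> of the Rademacher sum of \<open>T\<close>.\<close>
  define N where "N \<sigma> = nrm ?F (\<Sum>j<m. scl ?F (of_real (\<sigma> j)) (T j))" for \<sigma>
  have avg: "norm (\<Sum>j<m. T j (\<lambda>i\<in>{k+1..n}. s i j)) \<le>
      sqrt (sign_avg m (\<lambda>\<sigma>. (N \<sigma>)\<^sup>2)) * (\<Prod>i\<in>{k+1..n}. L2_norm (E i) (rad_sum (E i) (s i) m))"
  proof (rule multilinear_sum_le_sign_avg)
    fix \<sigma> x assume x: "x \<in> tuples {k+1..n} E"
    have En: "banach_RC K (E i)" if "i \<in> {k+1..n}" for i using E that by simp
    define G where "G = (\<Sum>j<m. scl ?F (of_real (\<sigma> j)) (T j))"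
    have G: "G x = (\<Sum>j<m. of_real (\<sigma> j) * T j x)" for x
      unfolding G_def F_def by (rule sum_scl_mult_space)
    \<comment> \<open>These bounds, drawn from continuity, make the set behind the
      \<open>op_norm\<close> of the signed sum bounded.\<close>
    have "\<exists>B. \<forall>x\<in>tuples {k+1..n} E. (\<forall>i\<in>{k+1..n}. nrm (E i) (x i) \<le> 1) \<longrightarrow> norm (T j x) \<le> B" for j
      using continuous_multilinear_bounded[OF T finite_atLeastAtMost En] by metis
    then obtain B where B: "\<And>j x. x \<in> tuples {k+1..n} E \<Longrightarrow>
        (\<And>i. i \<in> {k+1..n} \<Longrightarrow> nrm (E i) (x i) \<le> 1) \<Longrightarrow> norm (T j x) \<le> B j"
      by metis
    have "norm (G x) \<le> op_norm {k+1..n} E (scalars K) G * (\<Prod>i\<in>{k+1..n}. nrm (E i) (x i))"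
    proof (rule multilinear_le_op_norm[OF _ finite_atLeastAtMost x En])
      show "multilinear K {k+1..n} E (scalars K) G"
        using T(1) unfolding multilinear_def G
        by (simp add: scalars_def sum_distrib_left mult.left_commute flip: sum.distrib distrib_left)
      fix x assume "x \<in> tuples {k+1..n} E" "\<And>i. i \<in> {k+1..n} \<Longrightarrow> nrm (E i) (x i) \<le> 1"
      then show "norm (G x) \<le> (\<Sum>j<m. \<bar>\<sigma> j\<bar> * B j)"
        unfolding G using B by (intro sum_norm_le) (auto simp: norm_mult intro: mult_left_mono)
    qed
    then show "norm (\<Sum>j<m. of_real (\<sigma> j) * T j x) \<le> N \<sigma> * (\<Prod>i\<in>{k+1..n}. nrm (E i) (x i))"
      by (simp add: G N_def G_def[symmetric]) (simp add: F_def mult_space_def)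
  qed (use assms(3) E s T in auto)
  have eq: "norm (\<Sum>j<m. T j (\<lambda>i\<in>{k+1..n}. s i j)) = (\<Sum>j<m. norm (A (\<lambda>i\<in>{1..n}. s i j)))"
    unfolding TA of_real_sum[symmetric] norm_of_real by (simp add: sum_nonneg)
  have as: "sqrt (sign_avg m (\<lambda>\<sigma>. (N \<sigma>)\<^sup>2))
      \<le> C * (\<Prod>i\<in>{1..k}. nrm (weak_lp K 2 (E i)) (fin_family m (s i)))"
  proof -
    have "sqrt (sign_avg m (\<lambda>\<sigma>. (N \<sigma>)\<^sup>2)) = L2_norm ?F (rad_sum ?F T m)"
      unfolding L2_norm_rad_sum N_def ..
    also have "\<dots> \<le> nrm (Rad ?F) (fin_family m T)"
      by (rule Rad_fin_family_upper) (auto simp: F_def mult_space_def scalars_def)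
    also have "\<dots> \<le> C * (\<Prod>i\<in>{1..k}. nrm (weak_lp K 2 (E i)) (fin_family m (\<lambda>j. u j i)))"
      using C(2) u unfolding as_bound_def T_def by blast
    also have "\<dots> \<le> C * (\<Prod>i\<in>{1..k}. nrm (weak_lp K 2 (E i)) (fin_family m (s i)))"
    proof (intro mult_left_mono prod_mono C(1) conjI)
      fix i assume i: "i \<in> {1..k}"
      then have i_n: "i \<in> {1..n}" using assms(3) by simp
      interpret Ei: banach_RC K "E i" by (rule E[OF i_n])
      have "u j i \<in> vecs (E i)" for j using u i by (rule tuples_in)
      then show "0 \<le> nrm (weak_lp K 2 (E i)) (fin_family m (\<lambda>j. u j i))"
        by (intro Ei.weak_l2_nonneg Ei.fin_family_weak_l2)
      show "nrm (weak_lp K 2 (E i)) (fin_family m (\<lambda>j. u j i)) \<le> nrm (weak_lp K 2 (E i)) (fin_family m (s i))"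
      proof (cases "i = 1")
        case True
        \<comment> \<open>The inner truncation is needed because \<open>s i\<close> itself is not
          assumed weakly 2-summable.\<close>
        then have "fin_family m (\<lambda>j. u j i) = fin_family m (\<lambda>j. scl (E i) (\<theta> j) (fin_family m (s i) j))"
          using i by (auto simp: fin_family_def u_def)
        then show ?thesis
          using Ei.weak_l2_fin_family_scl_le[OF Ei.fin_family_weak_l2[OF s[OF i_n]] \<theta>(2,1)] by simp
      next
        case False
        then have "(\<lambda>j. u j i) = s i" using i by (auto simp: u_def)
        then show ?thesis by simp
      qed
    qed
    finally show ?thesis .
  qed
  have "0 \<le> (\<Prod>i\<in>{k+1..n}. L2_norm (E i) (rad_sum (E i) (s i) m))"
    by (intro prod_nonneg L2_norm_rad_sum_nonneg ballI)
  with avg show ?thesis unfolding eq by (rule order_trans[OF _ mult_right_mono[OF as]])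
qed

section \<open>From finite estimates to l_1 and to continuity\<close>

lemma nrm_l1_scalars:
  assumes "summable (\<lambda>j. norm (f j))"
  shows "nrm (lp_space 1 (scalars K)) f = (\<Sum>j. norm (f j))"
  using suminf_nonneg[OF assms] by (simp add: lp_space_def scalars_def)

lemma l1_bound:
  fixes f :: "nat \<Rightarrow> complex"
  assumes "\<And>m. (\<Sum>j<m. norm (f j)) \<le> B"
  shows "summable (\<lambda>j. norm (f j))" and "nrm (lp_space 1 (scalars K)) f \<le> B"
proof -
  show sm: "summable (\<lambda>j. norm (f j))" by (rule summableI_nonneg_bounded[OF _ assms]) simp
  show "nrm (lp_space 1 (scalars K)) f \<le> B"
    unfolding nrm_l1_scalars[OF sm] by (rule suminf_le_const[OF sm assms])
qed

text \<open>The difference of the values at y and x is telescoped by changing one slot at a time.\<close>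

lemma seq_map_continuous:
  fixes X :: "nat \<Rightarrow> (nat \<Rightarrow> 'a::ab_group_add) nspace"
  assumes I: "finite I" and A: "multilinear K I E (scalars K) A" and C: "C \<ge> 0"
    and vec: "\<And>i x j. i \<in> I \<Longrightarrow> x \<in> vecs (X i) \<Longrightarrow> x j \<in> vecs (E i)"
    and diff: "\<And>i x y. i \<in> I \<Longrightarrow> x \<in> vecs (X i) \<Longrightarrow> y \<in> vecs (X i) \<Longrightarrow> y - x \<in> vecs (X i)"
    and nonneg: "\<And>i x. i \<in> I \<Longrightarrow> x \<in> vecs (X i) \<Longrightarrow> 0 \<le> nrm (X i) x"
    and triangle: "\<And>i x y. i \<in> I \<Longrightarrow> x \<in> vecs (X i) \<Longrightarrow> y \<in> vecs (X i) \<Longrightarrow>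
      nrm (X i) y \<le> nrm (X i) x + nrm (X i) (y - x)"
    and bound: "\<And>s m. s \<in> tuples I X \<Longrightarrow>
      (\<Sum>j<m. norm (A (\<lambda>i\<in>I. s i j))) \<le> C * (\<Prod>i\<in>I. nrm (X i) (s i))"
  shows "continuous_map_on I X (lp_space 1 (scalars K)) (seq_map I A)"
  unfolding continuous_map_on_def
proof (intro ballI allI impI)
  fix x and e :: real assume x: "x \<in> tuples I X" and e: "e > 0"
  \<comment> \<open>Radii valid for every tuple that mixes entries of x and y, as d <= 1.\<close>
  define M where "M i = nrm (X i) (x i) + 1" for i
  define P where "P = (\<Prod>i\<in>I. M i)"
  have M: "M i \<ge> 1" if "i \<in> I" for i using nonneg[OF that tuples_in[OF x that]] by (simp add: M_def)
  have P: "P \<ge> 0" unfolding P_def using M by (intro prod_nonneg) force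
  \<comment> \<open>One contribution C * P for each slot changed, to be multiplied by d.\<close>
  define R where "R = real (card I) * C * P"
  have R: "R \<ge> 0" using C P by (simp add: R_def)
  \<comment> \<open>R + 1 in place of R avoids division by 0 and leaves R * d strictly below
    e.\<close>
  define d where "d = min 1 (e / (2 * (R + 1)))"
  have d: "d > 0" "d \<le> 1" using e R by (auto simp: d_def)
  show "\<exists>d>0. \<forall>y\<in>tuples I X. (\<forall>i\<in>I. nrm (X i) (y i - x i) < d) \<longrightarrow>
      nrm (lp_space 1 (scalars K)) (seq_map I A y - seq_map I A x) < e"
  proof (intro exI conjI ballI impI)
    fix y assume y: "y \<in> tuples I X" and near: "\<forall>i\<in>I. nrm (X i) (y i - x i) < d"
    let ?h = "\<lambda>J i. if i \<in> J then y i else x i"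
    have h: "?h J \<in> tuples I X" for J
      using x y by (auto simp: tuples_def PiE_def extensional_def)
    have nrm_h: "nrm (X i) (?h J i) \<le> M i" if "i \<in> I" for i J
      using triangle[OF that tuples_in[OF x that] tuples_in[OF y that]] near d that
      by (force simp: M_def)
    have step: "(\<Sum>j<m. norm (A (\<lambda>i\<in>I. ?h J i j) - A (\<lambda>i\<in>I. x i j))) \<le> real (card J) * C * P * d"
      if "J \<subseteq> I" for J m
      using finite_subset[OF that I] that
    proof (induction J rule: finite_induct)
      case empty
      then show ?case by simp
    next
      case (insert l J)
      have l: "l \<in> I" using insert.prems by simp
      \<comment> \<open>By multilinearity, changing slot l adds the value of A with the difference
        in that slot, which brings the factor d.\<close>
      let ?g = "(?h J)(l := y l - x l)"
      have g: "?g \<in> tuples I X"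
        using tuples_upd[OF h[of J], where i = l, OF diff[OF l tuples_in[OF x l] tuples_in[OF y l]]]
        by (simp add: insert_absorb[OF l])
      have "(\<Prod>i\<in>I. nrm (X i) (?g i)) = nrm (X l) (y l - x l) * (\<Prod>i\<in>I - {l}. nrm (X i) (?h J i))"
        using l I by (subst prod.remove[OF I l]) (auto intro!: prod.cong)
      also have "\<dots> \<le> d * (\<Prod>i\<in>I - {l}. M i)"
        using near l nonneg tuples_in[OF h[of J]] d nrm_h
        by (intro mult_mono prod_mono prod_nonneg) (auto intro: less_imp_le)
      also have "\<dots> \<le> d * P"
      proof -
        \<comment> \<open>Restoring the factor \<open>M l\<close>, which is at least 1, does not
          decrease the product.\<close>
        have "1 * (\<Prod>i\<in>I - {l}. M i) \<le> P"
          unfolding P_def prod.remove[OF I l] using M l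
          by (intro mult_right_mono prod_nonneg) force+
        then show ?thesis using d by simp
      qed
      finally have g_le: "(\<Prod>i\<in>I. nrm (X i) (?g i)) \<le> d * P" .
      have "A (\<lambda>i\<in>I. ?h (insert l J) i j) = A (\<lambda>i\<in>I. ?g i j) + A (\<lambda>i\<in>I. ?h J i j)" for j
      proof -
        let ?z = "\<lambda>i\<in>I. ?h J i j"
        have z: "?z \<in> tuples I E" using vec tuples_in[OF h[of J]] by (intro restrict_tuples) auto
        have "A (?z(l := (y l - x l) j + x l j)) = A (?z(l := (y l - x l) j)) + A (?z(l := x l j))"
          using vec[OF l] diff[OF l] tuples_in[OF x l] tuples_in[OF y l]
          by (intro multilinear_add[OF A z l]) blast+
        moreover have "?z(l := (y l - x l) j + x l j) = (\<lambda>i\<in>I. ?h (insert l J) i j)"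
          "?z(l := (y l - x l) j) = (\<lambda>i\<in>I. ?g i j)" "?z(l := x l j) = ?z"
          using l insert.hyps by (auto simp: fun_eq_iff)
        ultimately show ?thesis by simp
      qed
      then have "(\<Sum>j<m. norm (A (\<lambda>i\<in>I. ?h (insert l J) i j) - A (\<lambda>i\<in>I. x i j)))
          \<le> (\<Sum>j<m. norm (A (\<lambda>i\<in>I. ?g i j)) + norm (A (\<lambda>i\<in>I. ?h J i j) - A (\<lambda>i\<in>I. x i j)))"
        by (intro sum_mono) (simp add: norm_triangle_ineq flip: add_diff_eq)
      also have "\<dots> \<le> C * (\<Prod>i\<in>I. nrm (X i) (?g i)) + real (card J) * C * P * d"
        unfolding sum.distrib using insert.IH insert.prems by (intro add_mono bound[OF g]) blast
      also have "\<dots> \<le> C * (d * P) + real (card J) * C * P * d"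
        using g_le C by (intro add_right_mono mult_left_mono)
      also have "\<dots> = real (card (insert l J)) * C * P * d"
        using insert.hyps by (simp add: algebra_simps)
      finally show ?case .
    qed
    have "?h I i = y i" for i using x y by (auto simp: tuples_def PiE_def extensional_def)
    then have "(\<Sum>j<m. norm ((seq_map I A y - seq_map I A x) j)) \<le> R * d" for m
      using step[of I m] by (simp only: seq_map_def R_def fun_diff_def order_refl)
    then have "nrm (lp_space 1 (scalars K)) (seq_map I A y - seq_map I A x) \<le> R * d" by (rule l1_bound)
    also have "R * d \<le> R * (e / (2 * (R + 1)))" using R by (intro mult_left_mono) (simp add: d_def)
    also have "\<dots> < e" using R e by (simp add: field_simps add_nonneg_pos)
    finally show "nrm (lp_space 1 (scalars K)) (seq_map I A y - seq_map I A x) < e" .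
  qed (rule d)
qed

theorem theorem3p2:
  fixes K :: "complex set"
    and E :: "nat \<Rightarrow> 'a::ab_group_add nspace"
    and A :: "(nat \<Rightarrow> 'a) \<Rightarrow> complex"
    and k n :: nat
  defines "F \<equiv> mult_space K {k+1..n} E (scalars K)"
    and "Ak \<equiv> assoc_map k n E A"
    and "X \<equiv> (\<lambda>i. if i \<le> k then weak_lp K 2 (E i) else Rad (E i))"
    and "Y \<equiv> lp_space 1 (scalars K)"
  assumes "K = \<real> \<or> K = UNIV"
    and "1 \<le> k" and "k < n"
    and "\<And>i. i \<in> {1..n} \<Longrightarrow> banach_over K (E i)"
    and "A \<in> vecs (mult_space K {1..n} E (scalars K))"
    and "Ak \<in> almost_summing K {1..k} E F"
  shows "bounded_between {1..n} X Y (seq_map {1..n} A)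
    \<and> op_norm {1..n} X Y (seq_map {1..n} A) \<le> as_norm K {1..k} E F Ak
    \<and> A \<in> abs_summing K {1..n} 1 (\<lambda>i. if i \<le> k then 2 else 1) E (scalars K)"
proof -
  let ?I = "{1..n}"
  have RC: "banach_RC K (E i)" if "i \<in> ?I" for i
    using assms(5) assms(8)[OF that] by (intro banach_RC.intro banach_RC_axioms.intro)
  have A: "multilinear K ?I E (scalars K) A" and A_in: "\<And>x. x \<in> tuples ?I E \<Longrightarrow> A x \<in> K"
    using assms(9) by (auto simp: mult_space_def scalars_def)
  have Ak: "Ak \<in> vecs (mult_space K {1..k} E F)" using assms(10) by (simp add: almost_summing_def)
  note finite_bound = sum_norm_le_as_bound[OF assms(6,7) RC assms(9)
      Ak[unfolded F_def Ak_def], folded F_def Ak_def]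
  have split_prod: "(\<Prod>i\<in>?I. f i) = (\<Prod>i\<in>{1..k}. f i) * (\<Prod>i\<in>{k+1..n}. f i)" for f :: "nat \<Rightarrow> real"
  proof -
    have "?I = {1..k} \<union> {k+1..n}" using assms(6,7) by auto
    then show ?thesis by (simp add: prod.union_disjoint)
  qed
  have X_vec: "x j \<in> vecs (E i)" if "i \<in> ?I" "x \<in> vecs (X i)" for i x j
    using that(2) banach_RC.vecs_weak_l2[OF RC[OF that(1)]] by (auto simp: X_def Rad_def split: if_splits)
  have X_diff: "y - x \<in> vecs (X i)" if "i \<in> ?I" "x \<in> vecs (X i)" "y \<in> vecs (X i)" for i x y
    using that banach_RC.weak_l2_diff[OF RC[OF that(1)]] banach_RC.Rad_diff[OF RC[OF that(1)]]
    by (simp add: X_def split: if_splits)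
  have X_nonneg: "0 \<le> nrm (X i) x" if "i \<in> ?I" "x \<in> vecs (X i)" for i x
    using that banach_RC.weak_l2_nonneg[OF RC[OF that(1)]] banach_RC.Rad_nonneg[OF RC[OF that(1)]]
    by (simp add: X_def split: if_splits)
  have X_triangle: "nrm (X i) y \<le> nrm (X i) x + nrm (X i) (y - x)"
    if "i \<in> ?I" "x \<in> vecs (X i)" "y \<in> vecs (X i)" for i x y
    using that banach_RC.weak_l2_triangle[OF RC[OF that(1)]] banach_RC.Rad_triangle[OF RC[OF that(1)]]
    by (simp add: X_def split: if_splits)
  have bound: "(\<Sum>j<m. norm (A (\<lambda>i\<in>?I. s i j))) \<le> C * (\<Prod>i\<in>?I. nrm (X i) (s i))"
    if C: "C > 0" "as_bound K {1..k} E F Ak C" and s: "s \<in> tuples ?I X" for C s m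
  proof -
    have weak: "0 \<le> nrm (weak_lp K 2 (E i)) (fin_family m (s i))"
      "nrm (weak_lp K 2 (E i)) (fin_family m (s i)) \<le> nrm (X i) (s i)" if i: "i \<in> {1..k}" for i
    proof -
      have i_n: "i \<in> ?I" using i assms(7) by simp
      interpret Ei: banach_RC K "E i" by (rule RC[OF i_n])
      have si: "s i \<in> vecs (weak_lp K 2 (E i))" using tuples_in[OF s i_n] i by (simp add: X_def)
      show "0 \<le> nrm (weak_lp K 2 (E i)) (fin_family m (s i))"
        using X_vec[OF i_n tuples_in[OF s i_n]] by (intro Ei.weak_l2_nonneg Ei.fin_family_weak_l2)
      show "nrm (weak_lp K 2 (E i)) (fin_family m (s i)) \<le> nrm (X i) (s i)"
        using Ei.weak_l2_fin_family_le[OF si] i by (simp add: X_def)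
    qed
    have "(\<Sum>j<m. norm (A (\<lambda>i\<in>?I. s i j))) \<le>
      C * (\<Prod>i\<in>{1..k}. nrm (weak_lp K 2 (E i)) (fin_family m (s i)))
        * (\<Prod>i\<in>{k+1..n}. L2_norm (E i) (rad_sum (E i) (s i) m))"
      using C X_vec tuples_in[OF s] by (intro finite_bound) auto
    also have "\<dots> \<le> C * (\<Prod>i\<in>{1..k}. nrm (X i) (s i)) * (\<Prod>i\<in>{k+1..n}. nrm (X i) (s i))"
    proof (intro mult_mono mult_nonneg_nonneg prod_mono prod_nonneg ballI conjI weak)
      fix i assume "i \<in> {1..k}"
      then have "i \<in> ?I" using assms(7) by simp
      then show "0 \<le> nrm (X i) (s i)" by (intro X_nonneg tuples_in[OF s])
    next
      fix i assume i: "i \<in> {k+1..n}"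
      then have i_n: "i \<in> ?I" by simp
      have "s i \<in> vecs (Rad (E i))" using tuples_in[OF s i_n] i by (simp add: X_def)
      then show "L2_norm (E i) (rad_sum (E i) (s i) m) \<le> nrm (X i) (s i)"
        using banach_RC.Rad_upper[OF RC[OF i_n]] i by (simp add: X_def)
    qed (use C L2_norm_rad_sum_nonneg in auto)
    finally show ?thesis by (simp only: split_prod mult.assoc)
  qed
  \<comment> \<open>One admissible constant suffices for boundedness and for the summing property;
    the norm estimate lets C vary and passes to the infimum.\<close>
  obtain C0 where C0: "C0 > 0" "as_bound K {1..k} E F Ak C0"
    using assms(10) by (auto simp: almost_summing_def)
  have in_Y: "seq_map ?I A s \<in> vecs Y" if s: "s \<in> tuples ?I X" for s
  proof -
    have "A (\<lambda>i\<in>?I. s i j) \<in> K" for j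
      using X_vec tuples_in[OF s] by (intro A_in restrict_tuples) auto
    moreover have "summable (\<lambda>j. norm (A (\<lambda>i\<in>?I. s i j)))"
      by (rule l1_bound(1)[OF bound[OF C0 s]])
    ultimately show ?thesis by (simp add: Y_def lp_space_def scalars_def seq_map_def)
  qed
  have "continuous_map_on ?I X Y (seq_map ?I A)"
    unfolding Y_def
  proof (rule seq_map_continuous)
    show "multilinear K ?I E (scalars K) A" "0 \<le> C0" by (use A C0 in auto)
  qed (use X_vec X_diff X_nonneg X_triangle bound[OF C0] in \<open>blast intro: finite_atLeastAtMost\<close>)+
  with in_Y have bounded: "bounded_between ?I X Y (seq_map ?I A)" by (simp add: bounded_between_def)
  have "op_norm ?I X Y (seq_map ?I A) \<le> C" if C: "C > 0" "as_bound K {1..k} E F Ak C" for C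
    unfolding op_norm_def
  proof (rule cSUP_least)
    \<comment> \<open>The zero tuple shows that the supremum in \<open>op_norm\<close> is over a
      nonempty set.\<close>
    have "(\<lambda>_. 0) \<in> vecs (X i) \<and> nrm (X i) (\<lambda>_. 0) \<le> 1" if i: "i \<in> ?I" for i
    proof -
      interpret Ei: banach_RC K "E i" by (rule RC[OF i])
      have w: "(\<lambda>_. 0) \<in> vecs (weak_lp K 2 (E i))"
        by (auto simp: Ei.vecs_weak_l2 Ei.zero_closed Ei.dual_zero)
      have "nrm (weak_lp K 2 (E i)) (\<lambda>_. 0) \<le> 0"
        by (rule Ei.weak_l2_le[OF w])
          (simp add: Ei.partial_l2_def L2_set_def Ei.dual_zero[OF Ei.dual_ball_subset_dual])
      moreover have L0: "L2_norm (E i) (rad_sum (E i) (\<lambda>_. 0) m) = 0" for m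
        by (simp add: L2_norm_rad_sum sign_avg_const)
      have "nrm (Rad (E i)) (\<lambda>_. 0) \<le> 0" "(\<lambda>_. 0) \<in> vecs (Rad (E i))"
        by (auto simp: Rad_def L0 Ei.zero_closed)
      ultimately show ?thesis using w by (simp add: X_def)
    qed
    then have "(\<lambda>i\<in>?I. \<lambda>_. 0) \<in> {x \<in> tuples ?I X. \<forall>i\<in>?I. nrm (X i) (x i) \<le> 1}"
      by (auto intro!: restrict_tuples)
    then show "{x \<in> tuples ?I X. \<forall>i\<in>?I. nrm (X i) (x i) \<le> 1} \<noteq> {}" by blast
    fix s assume "s \<in> {x \<in> tuples ?I X. \<forall>i\<in>?I. nrm (X i) (x i) \<le> 1}"
    then have s: "s \<in> tuples ?I X" and s1: "\<And>i. i \<in> ?I \<Longrightarrow> nrm (X i) (s i) \<le> 1" by auto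
    have "nrm Y (seq_map ?I A s) \<le> C * (\<Prod>i\<in>?I. nrm (X i) (s i))"
      unfolding Y_def seq_map_def by (rule l1_bound(2)[OF bound[OF C s]])
    also have "(\<Prod>i\<in>?I. nrm (X i) (s i)) \<le> 1"
      using s1 X_nonneg tuples_in[OF s] by (intro prod_le_1) auto
    finally show "nrm Y (seq_map ?I A s) \<le> C" using C by simp
  qed
  then have norm_le: "op_norm ?I X Y (seq_map ?I A) \<le> as_norm K {1..k} E F Ak"
    unfolding as_norm_def using C0 by (intro cInf_greatest) auto
  have "nrm (lp_space 1 (scalars K)) (fin_family m (\<lambda>j. A (x j)))
      \<le> C0 * (\<Prod>i\<in>?I. nrm (weak_lp K (if i \<le> k then 2 else 1) (E i)) (fin_family m (\<lambda>j. x j i)))"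
    if x: "\<forall>j<m. x j \<in> tuples ?I E" for m x
  proof -
    \<comment> \<open>Nothing is known of \<open>x j\<close> for j >= m; the extension by 0 keeps
      all terms in the carriers.\<close>
    define s where "s i = fin_family m (\<lambda>j. x j i)" for i
    have s_vec: "s i j \<in> vecs (E i)" if "i \<in> ?I" for i j
      using x that banach_over.zero_closed[OF assms(8)[OF that]]
      by (auto simp: s_def fin_family_def intro: tuples_in)
    have fin_s: "fin_family m (s i) = s i" for i by (auto simp: s_def fin_family_def)
    have A_s: "A (\<lambda>i\<in>?I. s i j) = A (x j)" if "j < m" for j
    proof -
      have "(\<lambda>i\<in>?I. s i j) = x j"
        using x that by (auto simp: s_def fin_family_def tuples_def PiE_def extensional_def fun_eq_iff)
      then show ?thesis by simp
    qed
    have L2: "L2_norm (E i) (rad_sum (E i) (s i) m) \<le> nrm (weak_lp K 1 (E i)) (s i)"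
      if "i \<in> {k+1..n}" for i
      using banach_RC.L2_norm_rad_sum_le_weak_l1[OF RC, of i m "s i"] s_vec that fin_s by simp
    have W: "0 \<le> nrm (weak_lp K 2 (E i)) (s i)" if "i \<in> {1..k}" for i
      using banach_RC.fin_family_weak_l2[OF RC, of i m "s i"] banach_RC.weak_l2_nonneg[OF RC, of i "s i"]
        s_vec that fin_s assms(7) by simp
    have "(\<Sum>j<l. norm (fin_family m (\<lambda>j. A (x j)) j)) \<le> (\<Sum>j<m. norm (A (\<lambda>i\<in>?I. s i j)))" for l
    proof -
      have "(\<Sum>j<l. norm (fin_family m (\<lambda>j. A (x j)) j)) = (\<Sum>j<min l m. norm (A (x j)))"
        by (intro sum.mono_neutral_cong_right) (auto simp: fin_family_def)
      also have "\<dots> \<le> (\<Sum>j<m. norm (A (x j)))" by (intro sum_mono2) auto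
      also have "\<dots> = (\<Sum>j<m. norm (A (\<lambda>i\<in>?I. s i j)))"
        by (intro sum.cong refl) (simp only: A_s lessThan_iff)
      finally show ?thesis .
    qed
    then have "nrm (lp_space 1 (scalars K)) (fin_family m (\<lambda>j. A (x j))) \<le> (\<Sum>j<m. norm (A (\<lambda>i\<in>?I. s i j)))"
      by (rule l1_bound(2))
    also have "\<dots> \<le> C0 * (\<Prod>i\<in>{1..k}. nrm (weak_lp K 2 (E i)) (fin_family m (s i)))
        * (\<Prod>i\<in>{k+1..n}. L2_norm (E i) (rad_sum (E i) (s i) m))"
      using C0 s_vec by (intro finite_bound) auto
    also have "\<dots> = C0 * (\<Prod>i\<in>{1..k}. nrm (weak_lp K 2 (E i)) (s i))
        * (\<Prod>i\<in>{k+1..n}. L2_norm (E i) (rad_sum (E i) (s i) m))"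
      unfolding fin_s ..
    also have "\<dots> \<le> C0 * (\<Prod>i\<in>{1..k}. nrm (weak_lp K 2 (E i)) (s i))
        * (\<Prod>i\<in>{k+1..n}. nrm (weak_lp K 1 (E i)) (s i))"
      using L2 L2_norm_rad_sum_nonneg W C0
      by (intro mult_left_mono prod_mono mult_nonneg_nonneg prod_nonneg) auto
    also have "\<dots> = C0 * (\<Prod>i\<in>?I. nrm (weak_lp K (if i \<le> k then 2 else 1) (E i)) (s i))"
      unfolding split_prod by simp
    finally show ?thesis by (simp add: s_def)
  qed
  then have "A \<in> abs_summing K ?I 1 (\<lambda>i. if i \<le> k then 2 else 1) E (scalars K)"
    using assms(9) C0(1) unfolding abs_summing_def by blast
  with bounded norm_le show ?thesis by blast
qed

end
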